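(* Let $f:\mathbb{D}\to\mathbb{D}$ be holomorphic. Given $k\ge 1$, assume that $f$ is not a Blaschke product of degree at most $k$ and that $f(0)=f'(0)=\cdots=f^{(k-1)}(0)=0$. Let $\sigma_1,\ldots,\sigma_n\in\partial\mathbb{D}$ be distinct points such that $\beta_f(\sigma_j)<+\infty$ and $f(\sigma_j)=\sigma_j^k$ for $j=1,\ldots,n$. Then $$\sum_{j=1}^{n}\frac{1}{\beta_f(\sigma_j)-k}\le\frac{1-\left|\frac{f^{(k)}(0)}{k!}\right|^2}{\left|1-\frac{f^{(k)}(0)}{k!}\right|^2},$$ with equality if and only if $f$ is a Blaschke product of degree $n+k$.
   Context: $\mathbb{D}=\{z\in\mathbb{C}:|z|<1\}$ and $\partial\mathbb{D}$ is the unit circle. For a holomorphic $f:\mathbb{D}\to\mathbb{D}$ and $\sigma\in\partial\mathbb{D}$, the boundary dilation coefficient is $\beta_f(\sigma)=\liminf_{z\to\sigma}\frac{1-|f(z)|}{1-|z|}$. If $\beta_f(\sigma)<+\infty$, then $f$ has a non-tangential limit at $\sigma$ (limit as $z\to\sigma$ inside each region $\{z\in\mathbb{D}:|\sigma-z|<M(1-|z|)\}$, $M>1$), lying in $\partial\mathbb{D}$ and denoted $f(\sigma)$. A Blaschke product of degree $d\ge 1$ is a function $B(z)=e^{i\theta}\prod_{j=1}^d\frac{z-a_j}{1-\overline{a_j}z}$ with $\theta\in\mathbb{R}$, $a_1,\ldots,a_d\in\mathbb{D}$; those of degree $0$ are the constants of modulus $1$. Here $n\ge1$. For $k=1$ the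 condition on derivatives at $0$ reads just $f(0)=0$. *)

theory Defs
  imports "HOL-Complex_Analysis.Complex_Analysis"
begin

abbreviation unit_disc :: "complex set" where
  "unit_disc \<equiv> ball 0 1"

text \<open>
  Self-maps of the disc are total functions of type \<open>complex \<Rightarrow> complex\<close>; everything below depends
  only on their values on \<^abbrev>\<open>unit_disc\<close>.
\<close>

definition boundary_dilation :: "(complex \<Rightarrow> complex) \<Rightarrow> complex \<Rightarrow> ereal" where
  "boundary_dilation f \<sigma> =
     Liminf (at \<sigma> within unit_disc) (\<lambda>z. ereal ((1 - norm (f z)) / (1 - norm z)))"

definition stolz_region :: "complex \<Rightarrow> real \<Rightarrow> complex set" where
  "stolz_region \<sigma> M = {z \<in> unit_disc. norm (\<sigma> - z) < M * (1 - norm z)}"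

definition has_nontangential_limit :: "(complex \<Rightarrow> complex) \<Rightarrow> complex \<Rightarrow> complex \<Rightarrow> bool" where
  "has_nontangential_limit f \<sigma> l \<longleftrightarrow>
     (\<forall>M>1. (f \<longlongrightarrow> l) (at \<sigma> within stolz_region \<sigma> M))"

text \<open>For \<open>d = 0\<close> the product is empty, which leaves the constants of modulus 1.\<close>

definition blaschke_product :: "nat \<Rightarrow> (complex \<Rightarrow> complex) \<Rightarrow> bool" where
  "blaschke_product d f \<longleftrightarrow>
     (\<exists>(\<theta>::real) (a :: nat \<Rightarrow> complex).
        (\<forall>j\<in>{1..d}. a j \<in> unit_disc) \<and>
        (\<forall>z\<in>unit_disc. f z = cis \<theta> * (\<Prod>j=1..d. (z - a j) / (1 - cnj (a j) * z))))"

end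

theory Submission
  imports Defs "HOL-Computational_Algebra.Fundamental_Theorem_Algebra"
begin

text \<open>
  Write \<open>f z = z ^ k * g z\<close>. By the Schwarz lemma \<open>g\<close> maps the disc to the closed disc, and it stays in the
  open disc because \<open>f\<close> is not a Blaschke product of degree \<open>k\<close>. It has radial limit \<open>1\<close> at
  every \<open>\<sigma> j\<close>, and splitting \<open>1 - \<bar>z\<bar> ^ k * \<bar>g z\<bar>\<close> shows that the boundary dilation of \<open>g\<close> at \<open>\<sigma> j\<close> is
  \<open>\<beta> j - k\<close>, where \<open>\<beta> j\<close> is that of \<open>f\<close>. The Cayley transform \<open>h = (1 + g) / (1 - g)\<close> has positive real part, and
  the right-hand side of the inequality is \<open>Re (h 0)\<close>.
  
  By Herglotz, \<open>Re h\<close> is the Poisson integral of a positive measure of total mass \<open>Re (h 0)\<close>, and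
  \<open>1 / (\<beta> j - k)\<close> is the mass of the point \<open>\<sigma> j\<close>. The inequality says that these masses do not exceed the
  total. The measure itself can be avoided: the mass of \<open>\<sigma>\<close> is the largest \<open>c\<close> for which \<open>c\<close> times
  the Poisson kernel of \<open>\<sigma>\<close> is a minorant of \<open>Re h\<close>. That \<open>1 / (\<beta> j - k)\<close> is such a minorant is Julia's
  lemma (\<open>boundary_dilation_minorant\<close>), and that it is the largest one is
  \<open>boundary_dilation_minorant_maximal\<close>. Minorants at different points add up
  (\<open>herglotz_minorants_add\<close>), because subtracting one of them does not change the radial growth at the
  other points. Evaluation at \<open>0\<close> gives the inequality.
  
  Let \<open>H\<close> be \<open>h\<close> minus the sum of the kernels, so \<open>Re H \<ge> 0\<close>. Equality means \<open>Re (H 0) = 0\<close>, which forces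
  \<open>H\<close> to be an imaginary constant; then \<open>h\<close> is an explicit rational function and its inverse Cayley transform
  is a Blaschke product of degree \<open>n\<close> (\<open>herglotz_sum_cayley_blaschke\<close>). Conversely, if \<open>g\<close> is a Blaschke
  product of degree \<open>n\<close>, then \<open>h\<close> is rational with simple poles exactly at the \<open>\<sigma> j\<close>; maximality of the
  masses and \<open>Re H \<ge> 0\<close> remove the poles of \<open>H\<close>, so \<open>H\<close> is constant, and it is imaginary because \<open>\<bar>g\<bar> = 1\<close> on
  the circle (\<open>blaschke_cayley_total_mass\<close>). Degree \<open>n\<close> for \<open>g\<close> is degree \<open>n + k\<close> for \<open>f\<close>.
\<close>

section \<open>Cayley transform and Herglotz kernel\<close>

lemma Re_cayley: "Re ((1 + a) / (1 - a)) = (1 - (norm a)\<^sup>2) / (norm (1 - a))\<^sup>2"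
  unfolding cmod_power2 by (simp add: Re_divide power2_eq_square algebra_simps)

lemma cayley_pos:
  assumes "norm a < 1"
  shows "Re ((1 + a) / (1 - a)) > 0"
proof -
  have "a \<noteq> 1" using assms by auto
  then show ?thesis using assms by (simp add: Re_cayley power_less_one_iff)
qed

text \<open>
  Its real part is the Poisson kernel of \<open>\<sigma>\<close>; the holomorphic kernel itself is needed because the
  extremal functions are identified as sums of such kernels.
\<close>

definition herglotz_kernel :: "complex \<Rightarrow> complex \<Rightarrow> complex" where
  "herglotz_kernel \<sigma> z = (\<sigma> + z) / (\<sigma> - z)"

lemma Re_herglotz_kernel:
  assumes "norm \<sigma> = 1"
  shows "Re (herglotz_kernel \<sigma> z) = (1 - (norm z)\<^sup>2) / (norm (\<sigma> - z))\<^sup>2"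
proof -
  have "(Re \<sigma>)\<^sup>2 + (Im \<sigma>)\<^sup>2 = 1" using assms by (metis cmod_power2 one_power2)
  then show ?thesis
    unfolding cmod_power2 by (simp add: herglotz_kernel_def Re_divide power2_eq_square algebra_simps)
qed

section \<open>The invariant Schwarz lemma for the half-plane\<close>

lemma disc_pseudo_identity:
  "(norm (1 - cnj w * z))\<^sup>2 - (norm (z - w))\<^sup>2 = (1 - (norm z)\<^sup>2) * (1 - (norm w)\<^sup>2)"
  unfolding cmod_power2 by (simp add: algebra_simps power2_eq_square)

lemma halfplane_pseudo_identity:
  "(norm (a + cnj b))\<^sup>2 - (norm (a - b))\<^sup>2 = 4 * Re a * Re b"
  unfolding cmod_power2 by (simp add: algebra_simps power2_eq_square)

lemma disc_automorphism_in_disc: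
  assumes "z \<in> unit_disc" "w \<in> unit_disc"
  shows "1 - cnj w * z \<noteq> 0" "(z - w) / (1 - cnj w * z) \<in> unit_disc"
proof -
  have "norm z < 1" "norm w < 1" using assms by auto
  then have "(norm z)\<^sup>2 < 1" "(norm w)\<^sup>2 < 1"
    by (auto simp: power_less_one_iff)
  then have "(norm (z - w))\<^sup>2 < (norm (1 - cnj w * z))\<^sup>2"
    using disc_pseudo_identity[of w z] by (smt (verit, best) mult_pos_pos)
  then have "norm (z - w) < norm (1 - cnj w * z)"
    by (simp add: power_less_imp_less_base)
  then show "1 - cnj w * z \<noteq> 0" "(z - w) / (1 - cnj w * z) \<in> unit_disc"
    by (auto simp: norm_divide divide_simps)
qed

text \<open>
  The function \<open>(H - H w) / (H + cnj (H w))\<close> takes its values in the disc and vanishes at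
  \<open>w\<close>; after the disc automorphism that moves \<open>0\<close> to \<open>w\<close> the Schwarz lemma applies to it.
\<close>

lemma schwarz_pick_halfplane_strict:
  assumes hol: "H holomorphic_on unit_disc"
    and pos: "\<And>z. z \<in> unit_disc \<Longrightarrow> Re (H z) > 0"
    and z: "z \<in> unit_disc" and w: "w \<in> unit_disc"
  shows "norm (H z - H w) * norm (1 - cnj w * z) \<le> norm (z - w) * norm (H z + cnj (H w))"
proof -
  define \<phi> where "\<phi> = (\<lambda>\<zeta>. (\<zeta> + w) / (1 + cnj w * \<zeta>))"
  define \<psi> where "\<psi> = (\<lambda>\<zeta>. (H (\<phi> \<zeta>) - H w) / (H (\<phi> \<zeta>) + cnj (H w)))"
  have mw: "- w \<in> unit_disc" using w by simp
  have \<phi>: "\<phi> \<zeta> \<in> unit_disc" "1 + cnj w * \<zeta> \<noteq> 0" if "\<zeta> \<in> unit_disc" for \<zeta>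
    using disc_automorphism_in_disc[OF that mw] by (auto simp: \<phi>_def)
  have den: "H u + cnj (H w) \<noteq> 0" if "u \<in> unit_disc" for u
  proof -
    have "Re (H u + cnj (H w)) > 0" using pos[OF that] pos[OF w] by simp
    then show ?thesis by fastforce
  qed
  have h1: "\<phi> holomorphic_on unit_disc"
    unfolding \<phi>_def using \<phi> by (intro holomorphic_intros) auto
  have h2: "(H \<circ> \<phi>) holomorphic_on unit_disc"
    by (rule holomorphic_on_compose_gen[OF h1 hol]) (use \<phi> in auto)
  have hol\<psi>: "\<psi> holomorphic_on unit_disc"
    unfolding \<psi>_def using h2 den \<phi>(1) by (intro holomorphic_intros) (auto simp: o_def)
  have \<psi>0: "\<psi> 0 = 0" by (simp add: \<psi>_def \<phi>_def)
  have lt: "norm (\<psi> \<zeta>) < 1" if "norm \<zeta> < 1" for \<zeta>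
  proof -
    have u: "\<phi> \<zeta> \<in> unit_disc" using \<phi> that by auto
    have "0 < 4 * Re (H (\<phi> \<zeta>)) * Re (H w)" using pos[OF u] pos[OF w] by simp
    then have "(norm (H (\<phi> \<zeta>) - H w))\<^sup>2 < (norm (H (\<phi> \<zeta>) + cnj (H w)))\<^sup>2"
      using halfplane_pseudo_identity[of "H (\<phi> \<zeta>)" "H w"] by linarith
    then have "norm (H (\<phi> \<zeta>) - H w) < norm (H (\<phi> \<zeta>) + cnj (H w))"
      by (simp add: power_less_imp_less_base)
    then show ?thesis using den[OF u] by (simp add: \<psi>_def norm_divide divide_simps)
  qed
  define \<zeta> where "\<zeta> = (z - w) / (1 - cnj w * z)"
  have d: "1 - cnj w * z \<noteq> 0" "\<zeta> \<in> unit_disc"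
    unfolding \<zeta>_def using disc_automorphism_in_disc[OF z w] by auto
  have "1 - cnj w * w \<noteq> 0" using disc_automorphism_in_disc(1)[OF w w] .
  moreover have "(\<zeta> + w) * (1 - cnj w * z) = z * (1 - cnj w * w)"
    "(1 + cnj w * \<zeta>) * (1 - cnj w * z) = 1 - cnj w * w"
    using d(1) unfolding \<zeta>_def by (simp_all add: field_simps)
  ultimately have "\<phi> \<zeta> = z"
    unfolding \<phi>_def using d(1) by (metis mult_divide_mult_cancel_right nonzero_mult_div_cancel_right)
  then have "norm ((H z - H w) / (H z + cnj (H w))) \<le> norm \<zeta>"
    using Schwarz_Lemma(1)[OF hol\<psi> \<psi>0 lt, of \<zeta>] d(2) by (simp add: \<psi>_def)
  then show ?thesis
    using den[OF z] d(1) by (simp add: \<zeta>_def norm_divide divide_simps mult_ac)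
qed

text \<open>
  Allowing \<open>Re H = 0\<close>, by passing to \<open>H + \<epsilon>\<close>, matters later: once kernels have been subtracted
  from a function, only the weak inequality is known.
\<close>

lemma schwarz_pick_halfplane:
  assumes hol: "H holomorphic_on unit_disc"
    and pos: "\<And>z. z \<in> unit_disc \<Longrightarrow> Re (H z) \<ge> 0"
    and z: "z \<in> unit_disc" and w: "w \<in> unit_disc"
  shows "norm (H z - H w) * norm (1 - cnj w * z) \<le> norm (z - w) * norm (H z + cnj (H w))"
proof -
  let ?R = "\<lambda>\<epsilon>::real. norm (z - w) * norm (H z + cnj (H w) + of_real (2 * \<epsilon>))"
  have "(?R \<longlongrightarrow> ?R 0) (at_right 0)"
    by (intro tendsto_intros)
  moreover have "norm (H z - H w) * norm (1 - cnj w * z) \<le> ?R \<epsilon>" if "\<epsilon> > 0" for \<epsilon> :: real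
  proof -
    have "(\<lambda>z. H z + of_real \<epsilon>) holomorphic_on unit_disc" by (intro holomorphic_intros hol)
    from schwarz_pick_halfplane_strict[OF this _ z w]
    have "norm (H z + of_real \<epsilon> - (H w + of_real \<epsilon>)) * norm (1 - cnj w * z)
        \<le> norm (z - w) * norm (H z + of_real \<epsilon> + cnj (H w + of_real \<epsilon>))"
      using pos that by (simp add: add_nonneg_pos)
    then show ?thesis by (simp add: algebra_simps)
  qed
  then have "\<forall>\<^sub>F \<epsilon> in at_right 0. norm (H z - H w) * norm (1 - cnj w * z) \<le> ?R \<epsilon>"
    by (simp add: eventually_at_right_less eventually_at_filter)
  ultimately show ?thesis
    using tendsto_lowerbound[of ?R "?R 0" "at_right 0"] by simp
qed

text \<open>
  The two identities turn the bound on the pseudo-hyperbolic distance into a product form in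
  which \<open>w\<close> can be sent to the boundary.
\<close>

lemma schwarz_pick_halfplane_Re:
  assumes hol: "H holomorphic_on unit_disc"
    and pos: "\<And>z. z \<in> unit_disc \<Longrightarrow> Re (H z) \<ge> 0"
    and z: "z \<in> unit_disc" and w: "w \<in> unit_disc"
  shows "(1 - (norm z)\<^sup>2) * (1 - (norm w)\<^sup>2) * (norm (H z + cnj (H w)))\<^sup>2
           \<le> 4 * Re (H z) * Re (H w) * (norm (1 - cnj w * z))\<^sup>2"
proof -
  have "(norm (H z - H w) * norm (1 - cnj w * z))\<^sup>2 \<le> (norm (z - w) * norm (H z + cnj (H w)))\<^sup>2"
    by (intro power_mono schwarz_pick_halfplane[OF assms]) auto
  then show ?thesis
    unfolding disc_pseudo_identity[symmetric] halfplane_pseudo_identity[symmetric]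
    by (simp add: algebra_simps power_mult_distrib)
qed

section \<open>Julia's lemma and addition of boundary masses\<close>

lemma tendsto_radius:
  fixes \<sigma> :: complex
  shows "((\<lambda>r. of_real r * \<sigma>) \<longlongrightarrow> \<sigma>) (at_left (1::real))"
  by (rule tendsto_eq_intros refl)+ simp

lemma eventually_radius: "\<forall>\<^sub>F r::real in at_left 1. 0 < r \<and> r < 1"
  using eventually_at_left_field[of "\<lambda>r. 0 < r \<and> r < 1" 1] by (auto intro: exI[of _ 0])

lemma radius_in_disc: "norm \<sigma> = 1 \<Longrightarrow> 0 < r \<Longrightarrow> r < 1 \<Longrightarrow> of_real r * \<sigma> \<in> unit_disc"
  by (simp add: norm_mult)

lemma herglotz_kernel_radius:
  assumes "norm \<sigma> = 1"
  shows "herglotz_kernel \<sigma> (of_real r * \<sigma>) = of_real ((1 + r) / (1 - r))"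
proof -
  have "herglotz_kernel \<sigma> (of_real r * \<sigma>) = ((1 + of_real r) * \<sigma>) / ((1 - of_real r) * \<sigma>)"
    by (simp add: herglotz_kernel_def algebra_simps)
  also have "\<dots> = (1 + of_real r) / (1 - of_real r)"
    using assms by (subst mult_divide_mult_cancel_right) auto
  finally show ?thesis by simp
qed

text \<open>
  Here \<open>c\<close> is a lower bound for the mass at \<open>\<sigma>\<close> of the measure representing \<open>Re H\<close>. In the
  Schwarz-Pick inequality with \<open>w = r \<sigma>\<close>, the left side is estimated from below through
  \<open>\<bar>H z + cnj (H w)\<bar> \<ge> Re (H w)\<close>, one factor \<open>Re (H w)\<close> cancels, and the growth of the other one
  along the radius survives the limit \<open>r \<rightarrow> 1\<close>.
\<close>

lemma julia_halfplane:
  assumes hol: "H holomorphic_on unit_disc"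
    and pos: "\<And>z. z \<in> unit_disc \<Longrightarrow> Re (H z) \<ge> 0"
    and \<sigma>: "norm \<sigma> = 1"
    and q: "(q \<longlongrightarrow> c) (at_left (1::real))"
    and le: "\<forall>\<^sub>F r in at_left 1. q r \<le> (1 - r) / (1 + r) * Re (H (of_real r * \<sigma>))"
    and z: "z \<in> unit_disc"
  shows "c * Re (herglotz_kernel \<sigma> z) \<le> Re (H z)"
proof -
  have nz: "norm z < 1" using z by simp
  then have nz2: "1 - (norm z)\<^sup>2 > 0" by (simp add: power_less_one_iff)
  let ?L = "\<lambda>r. (1 - (norm z)\<^sup>2) * (1 + r)\<^sup>2 * q r"
  let ?R = "\<lambda>r. 4 * Re (H z) * (norm (1 - cnj (of_real r * \<sigma>) * z))\<^sup>2"
  have ev: "\<forall>\<^sub>F r in at_left 1. ?L r \<le> ?R r"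
    using le eventually_radius
  proof eventually_elim
    case (elim r)
    define w where "w = of_real r * \<sigma>"
    have w: "w \<in> unit_disc" unfolding w_def using radius_in_disc[OF \<sigma>] elim by auto
    have nw: "norm w = r" using elim \<sigma> by (simp add: w_def norm_mult)
    have ab: "Re (H z) \<ge> 0" "Re (H w) \<ge> 0" using pos z w by auto
    have r: "1 - r\<^sup>2 \<ge> 0" using elim by (simp add: abs_square_le_1)
    have "Re (H w) \<le> norm (H z + cnj (H w))"
      using ab complex_Re_le_cmod[of "H z + cnj (H w)"] by simp
    then have "(1 - (norm z)\<^sup>2) * (1 - r\<^sup>2) * (Re (H w))\<^sup>2
        \<le> (1 - (norm z)\<^sup>2) * (1 - r\<^sup>2) * (norm (H z + cnj (H w)))\<^sup>2"
      using ab nz2 r by (intro mult_left_mono power_mono) auto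
    also have "\<dots> \<le> 4 * Re (H z) * Re (H w) * (norm (1 - cnj w * z))\<^sup>2"
      using schwarz_pick_halfplane_Re[OF hol pos z w] nw by simp
    finally have *: "Re (H w) * ((1 - (norm z)\<^sup>2) * (1 - r\<^sup>2) * Re (H w))
        \<le> Re (H w) * ?R r" by (simp add: power2_eq_square w_def mult_ac)
    have **: "(1 - (norm z)\<^sup>2) * (1 - r\<^sup>2) * Re (H w) \<le> ?R r"
    proof (cases "Re (H w) = 0")
      case True
      then show ?thesis using ab by simp
    next
      case False
      then show ?thesis using * ab by simp
    qed
    have "?L r \<le> (1 - (norm z)\<^sup>2) * (1 + r)\<^sup>2 * ((1 - r) / (1 + r) * Re (H w))"
      using elim nz2 by (intro mult_left_mono) (auto simp: w_def)
    also have "(1 + r)\<^sup>2 * ((1 - r) / (1 + r)) = 1 - r\<^sup>2"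
      using elim by (simp add: power2_eq_square field_simps)
    then have "(1 - (norm z)\<^sup>2) * (1 + r)\<^sup>2 * ((1 - r) / (1 + r) * Re (H w))
       = (1 - (norm z)\<^sup>2) * (1 - r\<^sup>2) * Re (H w)"
      by (metis mult.assoc)
    finally show ?case using ** by linarith
  qed
  have L: "(?L \<longlongrightarrow> (1 - (norm z)\<^sup>2) * (1 + 1)\<^sup>2 * c) (at_left 1)"
    by (intro tendsto_intros q)
  have R: "(?R \<longlongrightarrow> 4 * Re (H z) * (norm (1 - cnj \<sigma> * z))\<^sup>2) (at_left 1)"
    by (intro tendsto_intros tendsto_radius)
  have "(1 - (norm z)\<^sup>2) * (1 + 1)\<^sup>2 * c \<le> 4 * Re (H z) * (norm (1 - cnj \<sigma> * z))\<^sup>2"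
    by (rule tendsto_le[OF _ R L ev]) simp
  moreover have "norm (1 - cnj \<sigma> * z) = norm (\<sigma> - z)"
  proof -
    have "cnj \<sigma> * \<sigma> = 1" using \<sigma> by (metis complex_mod_mult_cnj mult.commute complex_norm_square of_real_1 power_one)
    then have "1 - cnj \<sigma> * z = cnj \<sigma> * (\<sigma> - z)" by (simp add: algebra_simps)
    then show ?thesis using \<sigma> by (simp add: norm_mult)
  qed
  moreover have "\<sigma> \<noteq> z" using \<sigma> nz by auto
  ultimately show ?thesis
    by (simp add: Re_herglotz_kernel[OF \<sigma>] field_simps)
qed

lemma herglotz_kernel_holomorphic:
  assumes "norm \<sigma> = 1"
  shows "herglotz_kernel \<sigma> holomorphic_on unit_disc"
  unfolding herglotz_kernel_def[abs_def] using assms by (intro holomorphic_intros) auto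

text \<open>
  Masses at different points do not interact: a kernel of \<open>\<sigma> j\<close> stays bounded at \<open>\<sigma> i\<close>, so
  subtracting it leaves the radial growth at \<open>\<sigma> i\<close>, hence the mass there, unchanged.
\<close>

lemma herglotz_minorants_add:
  assumes hol: "H holomorphic_on unit_disc"
    and "finite J" and inj: "inj_on \<sigma> J" and \<sigma>: "\<And>j. j \<in> J \<Longrightarrow> norm (\<sigma> j) = 1"
    and pos: "\<And>z. z \<in> unit_disc \<Longrightarrow> Re (H z) \<ge> 0"
    and le: "\<And>j z. j \<in> J \<Longrightarrow> z \<in> unit_disc \<Longrightarrow> c j * Re (herglotz_kernel (\<sigma> j) z) \<le> Re (H z)"
    and z: "z \<in> unit_disc"
  shows "(\<Sum>j\<in>J. c j * Re (herglotz_kernel (\<sigma> j) z)) \<le> Re (H z)"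
  using \<open>finite J\<close> inj \<sigma> le z
proof (induction J arbitrary: z rule: finite_induct)
  case empty
  then show ?case using pos by simp
next
  case (insert i J)
  let ?K = "\<lambda>z. H z - (\<Sum>j\<in>J. of_real (c j) * herglotz_kernel (\<sigma> j) z)"
  let ?q = "\<lambda>r::real. c i - (\<Sum>j\<in>J. (1 - r) / (1 + r) * (c j * Re (herglotz_kernel (\<sigma> j) (of_real r * \<sigma> i))))"
  have IH: "(\<Sum>j\<in>J. c j * Re (herglotz_kernel (\<sigma> j) z)) \<le> Re (H z)" if "z \<in> unit_disc" for z
    using insert.prems insert.IH[of z] that by auto
  have ni: "norm (\<sigma> i) = 1" using insert.prems by auto
  have "((\<lambda>r. herglotz_kernel (\<sigma> j) (of_real r * \<sigma> i)) \<longlongrightarrow> herglotz_kernel (\<sigma> j) (\<sigma> i)) (at_left 1)"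
    if "j \<in> J" for j
  proof -
    have "\<sigma> j - \<sigma> i \<noteq> 0" using that insert by (auto simp: inj_on_def)
    then show ?thesis unfolding herglotz_kernel_def by (intro tendsto_intros tendsto_radius)
  qed
  then have "(?q \<longlongrightarrow> c i - (\<Sum>j\<in>J. (1 - 1) / (1 + 1) * (c j * Re (herglotz_kernel (\<sigma> j) (\<sigma> i))))) (at_left 1)"
    by (intro tendsto_intros) auto
  then have q: "(?q \<longlongrightarrow> c i) (at_left 1)" by simp
  have ev: "\<forall>\<^sub>F r in at_left 1. ?q r \<le> (1 - r) / (1 + r) * Re (?K (of_real r * \<sigma> i))"
    using eventually_radius
  proof eventually_elim
    case (elim r)
    have "c i * Re (herglotz_kernel (\<sigma> i) (of_real r * \<sigma> i)) \<le> Re (H (of_real r * \<sigma> i))"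
      using insert.prems(3)[of i] radius_in_disc[OF ni] elim by auto
    then have "(1 - r) / (1 + r) * (c i * ((1 + r) / (1 - r))) \<le> (1 - r) / (1 + r) * Re (H (of_real r * \<sigma> i))"
      using elim by (intro mult_left_mono) (auto simp: herglotz_kernel_radius[OF ni])
    moreover have "(1 - r) / (1 + r) * (c i * ((1 + r) / (1 - r))) = c i"
      using elim by simp
    ultimately have "c i \<le> (1 - r) / (1 + r) * Re (H (of_real r * \<sigma> i))" by simp
    then show ?case by (simp add: right_diff_distrib sum_distrib_left)
  qed
  have "c i * Re (herglotz_kernel (\<sigma> i) z) \<le> Re (?K z)"
  proof (rule julia_halfplane[OF _ _ ni q ev insert.prems(4)])
    show "?K holomorphic_on unit_disc"
      using insert.prems by (intro holomorphic_intros hol herglotz_kernel_holomorphic) auto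
    show "Re (?K z) \<ge> 0" if "z \<in> unit_disc" for z using IH[OF that] by simp
  qed
  then show ?case using insert.hyps by simp
qed

text \<open>
  A minimum principle: if \<open>Re (H 0) = 0\<close>, then \<open>cnj (H 0) = - H 0\<close>, and the Schwarz-Pick inequality
  at \<open>0\<close> compares \<open>\<bar>H z - H 0\<bar>\<close> with \<open>\<bar>z\<bar>\<close> times itself.
\<close>

lemma Re_nonneg_vanishing_imp_constant:
  assumes hol: "H holomorphic_on unit_disc"
    and pos: "\<And>z. z \<in> unit_disc \<Longrightarrow> Re (H z) \<ge> 0"
    and "Re (H 0) = 0" and z: "z \<in> unit_disc"
  shows "H z = H 0"
proof (rule ccontr)
  assume ne: "H z \<noteq> H 0"
  have "cnj (H 0) = - H 0" using assms(3) by (simp add: complex_eq_iff)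
  with schwarz_pick_halfplane[OF hol pos z, of 0]
  have "norm (H z - H 0) \<le> norm z * norm (H z - H 0)" by simp
  then show False using ne z by simp
qed

section \<open>Finite sums of kernels give Blaschke products\<close>

text \<open>
  An arbitrary finite index set makes it possible to discard factors without renumbering.
\<close>

lemma blaschke_productI:
  assumes "finite I" "card I = d" and a: "\<And>i. i \<in> I \<Longrightarrow> a i \<in> unit_disc" and "norm \<omega> = 1"
    and f: "\<And>z. z \<in> unit_disc \<Longrightarrow> f z = \<omega> * (\<Prod>i\<in>I. (z - a i) / (1 - cnj (a i) * z))"
  shows "blaschke_product d f"
proof -
  obtain b where b: "bij_betw b {1..d} I"
    using ex_bij_betw_nat_finite_1[OF assms(1)] assms(2) by blast
  have "\<omega> \<noteq> 0" using assms(4) by auto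
  then have "cis (Arg \<omega>) = \<omega>" using assms(4) by (simp add: cis_Arg sgn_div_norm)
  moreover have "(\<Prod>i\<in>I. (z - a i) / (1 - cnj (a i) * z))
      = (\<Prod>j=1..d. (z - a (b j)) / (1 - cnj (a (b j)) * z))" for z
    using prod.reindex_bij_betw[OF b, of "\<lambda>i. (z - a i) / (1 - cnj (a i) * z)"] by simp
  moreover have "\<forall>j\<in>{1..d}. a (b j) \<in> unit_disc" using a b by (meson bij_betwE)
  ultimately show ?thesis
    unfolding blaschke_product_def using f by (intro exI[of _ "Arg \<omega>"] exI[of _ "\<lambda>j. a (b j)"]) auto
qed

lemma degree_prod_monic_linear:
  fixes \<sigma> :: "'i \<Rightarrow> complex"
  shows "finite J \<Longrightarrow> degree (\<Prod>j\<in>J. [:- \<sigma> j, 1:]) = card J"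
  by (subst degree_prod_eq_sum_degree) auto

lemma lead_coeff_prod_monic_linear:
  fixes \<sigma> :: "'i \<Rightarrow> complex"
  assumes "finite J"
  shows "coeff (\<Prod>j\<in>J. [:- \<sigma> j, 1:]) (card J) = 1"
proof -
  have "lead_coeff (\<Prod>j\<in>J. [:- \<sigma> j, 1:]) = 1" by (simp add: lead_coeff_prod)
  then show ?thesis using degree_prod_monic_linear[OF assms, of \<sigma>] by simp
qed

text \<open>
  The numerator of \<open>\<Sum>j\<in>J. c j * herglotz_kernel (\<sigma> j) z\<close> over the common denominator
  \<open>\<Prod>j\<in>J. z - \<sigma> j\<close>. The denominator is taken monic, which causes the minus sign.
\<close>

definition herglotz_numerator :: "('i \<Rightarrow> real) \<Rightarrow> ('i \<Rightarrow> complex) \<Rightarrow> 'i set \<Rightarrow> complex poly" where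
  "herglotz_numerator c \<sigma> J =
     - (\<Sum>j\<in>J. smult (of_real (c j)) ([:\<sigma> j, 1:] * (\<Prod>i\<in>J - {j}. [:- \<sigma> i, 1:])))"

lemma poly_herglotz_numerator:
  assumes "finite J" "z \<notin> \<sigma> ` J"
  shows "poly (herglotz_numerator c \<sigma> J) z =
    (\<Sum>j\<in>J. of_real (c j) * herglotz_kernel (\<sigma> j) z) * (\<Prod>j\<in>J. z - \<sigma> j)"
proof -
  have "of_real (c j) * herglotz_kernel (\<sigma> j) z * (\<Prod>j\<in>J. z - \<sigma> j)
      = - (of_real (c j) * ((\<sigma> j + z) * (\<Prod>i\<in>J - {j}. z - \<sigma> i)))" if "j \<in> J" for j
  proof -
    have "\<sigma> j - z \<noteq> 0" using that assms(2) by auto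
    then have "herglotz_kernel (\<sigma> j) z * (z - \<sigma> j) = - (\<sigma> j + z)"
      by (simp add: herglotz_kernel_def field_simps)
    moreover have "(\<Prod>j\<in>J. z - \<sigma> j) = (z - \<sigma> j) * (\<Prod>i\<in>J - {j}. z - \<sigma> i)"
      using assms(1) that by (rule prod.remove)
    ultimately show ?thesis by (metis (no_types, lifting) mult.assoc mult_minus_left mult_minus_right)
  qed
  then show ?thesis
    by (simp add: herglotz_numerator_def poly_sum poly_prod sum_distrib_right sum_negf del: mult_pCons_left)
qed

text \<open>
  At \<open>\<sigma> j\<close> only the \<open>j\<close>-th term survives, so for distinct nodes and nonzero weights the numerator
  does not vanish where the denominator does.
\<close>

lemma poly_herglotz_numerator_node:
  assumes "finite J" "j \<in> J"
  shows "poly (herglotz_numerator c \<sigma> J) (\<sigma> j) =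
    - (2 * of_real (c j) * \<sigma> j * (\<Prod>i\<in>J - {j}. \<sigma> j - \<sigma> i))"
proof -
  let ?t = "\<lambda>l. of_real (c l) * ((\<sigma> l + \<sigma> j) * (\<Prod>i\<in>J - {l}. \<sigma> j - \<sigma> i))"
  have z: "?t l = 0" if "l \<in> J - {j}" for l
  proof -
    have "(\<Prod>i\<in>J - {l}. \<sigma> j - \<sigma> i) = 0" using that assms by (intro prod_zero bexI[of _ j]) auto
    then show ?thesis by simp
  qed
  have "(\<Sum>l\<in>J. ?t l) = ?t j + (\<Sum>l\<in>J - {j}. ?t l)"
    using assms by (rule sum.remove)
  also have "(\<Sum>l\<in>J - {j}. ?t l) = 0" by (rule sum.neutral) (use z in blast)
  finally have "(\<Sum>l\<in>J. ?t l) = ?t j" by simp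
  then show ?thesis
    by (simp add: herglotz_numerator_def poly_sum poly_prod mult.assoc del: mult_pCons_left)
qed

lemma degree_herglotz_numerator_le:
  assumes "finite J"
  shows "degree (herglotz_numerator c \<sigma> J) \<le> card J"
proof -
  have "degree (smult (of_real (c j)) ([:\<sigma> j, 1:] * (\<Prod>i\<in>J - {j}. [:- \<sigma> i, 1:]))) \<le> card J"
    if "j \<in> J" for j
  proof -
    have "degree ([:\<sigma> j, 1:] * (\<Prod>i\<in>J - {j}. [:- \<sigma> i, 1:])) \<le> 1 + (card J - 1)"
      using assms that degree_prod_monic_linear[of "J - {j}" \<sigma>]
      by (intro order_trans[OF degree_mult_le]) auto
    moreover have "card J \<ge> 1" using assms that by (auto simp: Suc_le_eq card_gt_0_iff)
    ultimately show ?thesis using order_trans[OF degree_smult_le] by (metis le_add_diff_inverse)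
  qed
  then show ?thesis using assms by (auto simp: herglotz_numerator_def intro: degree_sum_le)
qed

lemma coeff_herglotz_numerator:
  assumes "finite J"
  shows "coeff (herglotz_numerator c \<sigma> J) (card J) = - (\<Sum>j\<in>J. of_real (c j))"
proof -
  have "coeff ([:\<sigma> j, 1:] * (\<Prod>i\<in>J - {j}. [:- \<sigma> i, 1:])) (card J) = 1" if "j \<in> J" for j
  proof -
    have "lead_coeff ([:\<sigma> j, 1:] * (\<Prod>i\<in>J - {j}. [:- \<sigma> i, 1:])) = 1"
      by (simp only: lead_coeff_mult) (simp add: lead_coeff_prod)
    moreover have "degree ([:\<sigma> j, 1:] * (\<Prod>i\<in>J - {j}. [:- \<sigma> i, 1:])) = 1 + card (J - {j})"
      using assms degree_prod_monic_linear[of "J - {j}" \<sigma>] by (subst degree_mult_eq) auto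
    moreover have "1 + card (J - {j}) = card J" using card_Suc_Diff1[OF assms that] by simp
    ultimately show ?thesis by metis
  qed
  then show ?thesis
    by (simp add: herglotz_numerator_def coeff_sum del: mult_pCons_left)
qed

lemma Re_herglotz_kernel_circle:
  assumes "norm \<sigma> = 1" "norm z = 1"
  shows "Re (herglotz_kernel \<sigma> z) = 0"
  using assms by (simp add: Re_herglotz_kernel)

lemma Re_herglotz_kernel_pos:
  assumes "norm \<sigma> = 1" "z \<in> unit_disc"
  shows "Re (herglotz_kernel \<sigma> z) > 0"
proof -
  have "\<sigma> \<noteq> z" "norm z < 1" using assms by auto
  then show ?thesis using assms by (simp add: Re_herglotz_kernel power_less_one_iff)
qed

lemma Re_herglotz_kernel_nonpos:
  assumes "norm \<sigma> = 1" "norm z \<ge> 1"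
  shows "Re (herglotz_kernel \<sigma> z) \<le> 0"
  using assms by (simp add: Re_herglotz_kernel divide_nonpos_nonneg one_le_power)

lemma infinite_circle_minus_finite:
  assumes "finite F"
  shows "infinite (sphere (0::complex) 1 - F)"
proof -
  have "infinite (sphere (0::complex) 1)"
  proof -
    have "connected (sphere (0::complex) 1)" by (rule connected_sphere) simp
    moreover have "1 \<in> sphere (0::complex) 1" "-1 \<in> sphere (0::complex) 1" by auto
    ultimately show ?thesis using connected_finite_iff_sing[of "sphere (0::complex) 1"]
      by (metis empty_iff one_neq_neg_one singletonD)
  qed
  then show ?thesis using assms by simp
qed

lemma circle_inverse: "norm (z::complex) = 1 \<Longrightarrow> z * cnj z = 1"
  by (metis complex_norm_square of_real_1 power_one)

lemma circle_linear_reflection: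
  assumes "norm (z::complex) = 1"
  shows "z - a = z * cnj (1 - cnj a * z)"
  using circle_inverse[OF assms] by (simp add: algebra_simps)

lemma circle_difference_reflection:
  assumes "norm (z::complex) = 1" "norm (s::complex) = 1"
  shows "z - s = - s * (z * cnj (z - s))"
proof -
  have "- s * (z * cnj (z - s)) = z * (s * cnj s) - s * (z * cnj z)" by (simp add: algebra_simps)
  then show ?thesis using circle_inverse assms by simp
qed

text \<open>
  With \<open>h = N / Q\<close> the transform is \<open>A / B\<close>, where \<open>A = N - Q\<close> and \<open>B = N + Q\<close>. As \<open>Re h \<le> 0\<close> off
  the disc, all zeros of \<open>A\<close> lie in the disc. As \<open>h\<close> is imaginary on the circle, \<open>B\<close> is there, up
  to a unimodular constant, the reflection of \<open>A\<close>; both being polynomials, the zeros of \<open>B\<close> are the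
  mirror images of those of \<open>A\<close>, which is the shape of a Blaschke product.
\<close>

lemma herglotz_sum_cayley_blaschke:
  fixes \<sigma> :: "'i \<Rightarrow> complex"
  assumes J: "finite J" and inj: "inj_on \<sigma> J"
    and \<sigma>: "\<And>j. j \<in> J \<Longrightarrow> norm (\<sigma> j) = 1" and c: "\<And>j. j \<in> J \<Longrightarrow> c j > 0"
    and E: "Re E = 0"
    and h: "\<And>z. z \<in> unit_disc \<Longrightarrow> h z = E + (\<Sum>j\<in>J. of_real (c j) * herglotz_kernel (\<sigma> j) z)"
  shows "blaschke_product (card J) (\<lambda>z. (h z - 1) / (h z + 1))"
proof -
  define n where "n = card J"
  define S where "S = (\<lambda>z. E + (\<Sum>j\<in>J. of_real (c j) * herglotz_kernel (\<sigma> j) z))"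
  define Q where "Q = (\<Prod>j\<in>J. [:- \<sigma> j, 1:])"
  define N where "N = smult E Q + herglotz_numerator c \<sigma> J"
  define A where "A = N - Q"
  define B where "B = N + Q"
  have Q: "poly Q z = (\<Prod>j\<in>J. z - \<sigma> j)" for z by (simp add: Q_def poly_prod)
  have N: "poly N z = S z * poly Q z" if "z \<notin> \<sigma> ` J" for z
    using poly_herglotz_numerator[OF J that] by (simp add: N_def S_def Q distrib_right)
  have ReS: "Re (S z) = (\<Sum>j\<in>J. c j * Re (herglotz_kernel (\<sigma> j) z))" for z
    using E by (simp add: S_def)
  have degQ: "degree Q = n" "coeff Q n = 1"
    unfolding n_def Q_def using degree_prod_monic_linear[OF J] lead_coeff_prod_monic_linear[OF J] by auto
  \<comment> \<open>The coefficient of degree \<open>n\<close> has real part at most \<open>-1\<close>, so no zero escapes to infinity.\<close>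
  have degA: "degree A = n"
  proof (rule antisym)
    show "degree A \<le> n" unfolding A_def N_def
      using degQ degree_herglotz_numerator_le[OF J, of c \<sigma>]
      using order_trans[OF degree_smult_le, of Q n E]
      by (intro degree_diff_le degree_add_le) (auto simp: n_def)
    have "coeff A n = E - (\<Sum>j\<in>J. of_real (c j)) - 1"
      using degQ coeff_herglotz_numerator[OF J, of c \<sigma>] by (simp add: A_def N_def n_def)
    moreover have "Re (E - (\<Sum>j\<in>J. of_real (c j)) - 1) < 0"
      using E sum_nonneg[of J c] c by (simp add: less_imp_le)
    ultimately have "coeff A n \<noteq> 0" by (metis less_irrefl zero_complex.sel(1))
    then show "n \<le> degree A" by (rule le_degree)
  qed
  \<comment> \<open>Off the disc \<open>Re h \<le> 0\<close>, so \<open>h = 1\<close> is impossible; the poles are treated separately.\<close>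
  have nz: "poly A z \<noteq> 0" if "norm z \<ge> 1" for z
  proof (cases "z \<in> \<sigma> ` J")
    case True
    then obtain j where j: "j \<in> J" "z = \<sigma> j" by auto
    have "poly Q z = 0" unfolding Q using J j by (intro prod_zero) auto
    then have "poly A z = - (2 * of_real (c j) * \<sigma> j * (\<Prod>i\<in>J - {j}. \<sigma> j - \<sigma> i))"
      using poly_herglotz_numerator_node[OF J j(1), of c \<sigma>] j by (simp add: A_def N_def)
    moreover have "(\<Prod>i\<in>J - {j}. \<sigma> j - \<sigma> i) \<noteq> 0"
      using J inj j by (auto simp: inj_on_def)
    moreover have "c j \<noteq> 0" "\<sigma> j \<noteq> 0" using c[OF j(1)] \<sigma>[OF j(1)] by auto
    ultimately show ?thesis by simp
  next
    case False
    have "Re (S z) \<le> 0" unfolding ReS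
      using Re_herglotz_kernel_nonpos[OF \<sigma> that] c
      by (intro sum_nonpos) (auto simp: mult_le_0_iff less_imp_le)
    then have "S z - 1 \<noteq> 0" by (auto simp: complex_eq_iff)
    moreover have "poly Q z \<noteq> 0" using False J by (auto simp: Q)
    ultimately show ?thesis using N[OF False] by (simp add: A_def algebra_simps)
  qed
  obtain root where "smult (lead_coeff A) (\<Prod>i<degree A. [:- root i, 1:]) = A"
    by (rule complex_poly_decompose')
  then have fact: "A = smult (lead_coeff A) (\<Prod>i<n. [:- root i, 1:])" using degA by simp
  have polyA: "poly A z = lead_coeff A * (\<Prod>i<n. z - root i)" for z
    by (subst fact) (simp add: poly_prod)
  have L: "lead_coeff A \<noteq> 0" using nz[of 1] by auto
  have root: "root i \<in> unit_disc" if "i < n" for i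
  proof -
    have "poly A (root i) = 0" unfolding polyA using that by (auto intro!: prod_zero)
    then show ?thesis using nz[of "root i"] by fastforce
  qed
  \<comment> \<open>The reflection of the monic polynomial with the zeros of \<open>A\<close>.\<close>
  define T where "T = (\<Prod>i<n. [:1, - cnj (root i):])"
  have T: "poly T z = (\<Prod>i<n. 1 - cnj (root i) * z)" for z by (simp add: T_def poly_prod mult.commute)
  define K where "K = (\<Prod>j\<in>J. - \<sigma> j)"
  have K: "norm K = 1" unfolding K_def using \<sigma> by (simp add: prod_norm[symmetric])
  define M where "M = - (cnj (lead_coeff A) / cnj K)"
  have M: "norm M = norm (lead_coeff A)" using K by (simp add: M_def norm_divide)
  have circ: "poly B z = poly (smult M T) z"
    if "z \<in> sphere 0 1 - \<sigma> ` J" for z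
  proof -
    have z: "norm z = 1" "z \<notin> \<sigma> ` J" "z \<noteq> 0" using that by auto
    have "poly Q z = (\<Prod>j\<in>J. - \<sigma> j * (z * cnj (z - \<sigma> j)))"
      unfolding Q by (intro prod.cong refl circle_difference_reflection z(1) \<sigma>)
    moreover have "(\<Prod>j\<in>J. - \<sigma> j * (z * cnj (z - \<sigma> j))) = K * ((\<Prod>j\<in>J. z) * (\<Prod>j\<in>J. cnj (z - \<sigma> j)))"
      unfolding K_def by (subst prod.distrib, subst prod.distrib) (rule refl)
    moreover have "(\<Prod>j\<in>J. z) = z ^ n" by (simp add: n_def)
    moreover have "(\<Prod>j\<in>J. cnj (z - \<sigma> j)) = cnj (poly Q z)" unfolding Q by (rule cnj_prod[symmetric])
    ultimately have Qr: "poly Q z = K * z ^ n * cnj (poly Q z)" by (metis mult.assoc)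
    have "Re (S z) = 0" unfolding ReS
      using Re_herglotz_kernel_circle[OF \<sigma> z(1)] by simp
    then have S: "cnj (S z) = - S z" by (simp add: complex_eq_iff)
    have "poly A z = (S z - 1) * (K * z ^ n * cnj (poly Q z))"
      using N[OF z(2)] Qr by (simp add: A_def left_diff_distrib)
    also have "\<dots> = - (K * z ^ n * cnj (poly B z))"
      using N[OF z(2)] S by (simp add: B_def algebra_simps)
    finally have 1: "poly A z = - (K * z ^ n * cnj (poly B z))" .
    have "(\<Prod>i<n. z - root i) = (\<Prod>i<n. z * cnj (1 - cnj (root i) * z))"
      using circle_linear_reflection[OF z(1)] by metis
    then have 2: "poly A z = lead_coeff A * (z ^ n * cnj (poly T z))"
      by (simp add: polyA T prod.distrib)
    have "z ^ n * (lead_coeff A * cnj (poly T z)) = z ^ n * (- (K * cnj (poly B z)))"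
      using trans[OF 2[symmetric] 1] by (simp only: mult_minus_right mult_ac)
    then have "lead_coeff A * cnj (poly T z) = - (K * cnj (poly B z))"
      using z(3) by (metis mult_left_cancel power_not_zero)
    then have "cnj (lead_coeff A * cnj (poly T z)) = cnj (- (K * cnj (poly B z)))" by (rule arg_cong)
    then have "cnj (lead_coeff A) * poly T z = - (cnj K * poly B z)"
      by (simp only: complex_cnj_cnj complex_cnj_minus complex_cnj_mult)
    moreover have "cnj K \<noteq> 0" using K by auto
    moreover have "b = - (a / k) * t" if "a * t = - (k * b)" "k \<noteq> 0" for a b k t :: complex
      using that by (simp add: field_simps)
    ultimately have "poly B z = M * poly T z" unfolding M_def by blast
    then show ?thesis by (simp only: poly_smult)
  qed
  have B: "B = smult M T"
  proof (rule ccontr)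
    assume "B \<noteq> smult M T"
    then have "finite {z. poly (B - smult M T) z = 0}"
      by (intro poly_roots_finite) simp
    moreover have "poly (B - smult M T) z = 0" if "z \<in> sphere 0 1 - \<sigma> ` J" for z
      using circ[OF that] by simp
    then have "sphere 0 1 - \<sigma> ` J \<subseteq> {z. poly (B - smult M T) z = 0}" by blast
    ultimately have "finite (sphere 0 1 - \<sigma> ` J)" by (rule rev_finite_subset)
    then show False using infinite_circle_minus_finite[of "\<sigma> ` J"] J by simp
  qed
  define \<omega> where "\<omega> = lead_coeff A / M"
  have "blaschke_product n (\<lambda>z. (h z - 1) / (h z + 1))"
  proof (rule blaschke_productI[where I = "{..<n}" and a = root and \<omega> = \<omega>])
    show "norm \<omega> = 1" using M L by (simp add: \<omega>_def norm_divide)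
    fix z assume z: "z \<in> unit_disc"
    then have zJ: "z \<notin> \<sigma> ` J" using \<sigma> by auto
    then have "poly Q z \<noteq> 0" using J by (auto simp: Q)
    moreover have "h z = S z" using h[OF z] by (simp add: S_def)
    ultimately have "(h z - 1) / (h z + 1) = (poly Q z * (S z - 1)) / (poly Q z * (S z + 1))" by simp
    also have "\<dots> = poly A z / poly B z"
      using N[OF zJ] by (simp add: A_def B_def algebra_simps)
    also have "\<dots> = \<omega> * (\<Prod>i<n. (z - root i) / (1 - cnj (root i) * z))"
      unfolding B poly_smult polyA T \<omega>_def prod_dividef times_divide_times_eq ..
    finally show "(h z - 1) / (h z + 1) = \<omega> * (\<Prod>i<n. (z - root i) / (1 - cnj (root i) * z))" .
  qed (use root in auto)
  then show ?thesis by (simp add: n_def)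
qed

section \<open>Total mass of a Blaschke product\<close>

text \<open>
  A nonnegative real part together with zero mass at \<open>\<sigma>\<close> excludes a simple pole there. Along
  \<open>(1 - \<rho> u) \<sigma>\<close> the function behaves like \<open>e' / (u \<rho>)\<close> with \<open>e' = e / \<sigma>\<close>. The radius \<open>u = 1\<close> shows that
  \<open>Re e' / 2\<close> is a mass, hence \<open>Re e' = 0\<close>; the oblique directions \<open>u = 1 \<plusminus> \<i>\<close> would see opposite
  signs of \<open>Re H\<close> if \<open>Im e'\<close> were nonzero.
\<close>

lemma nonneg_Re_pole_coefficient_eq_0:
  assumes hol: "H holomorphic_on unit_disc"
    and pos: "\<And>z. z \<in> unit_disc \<Longrightarrow> Re (H z) \<ge> 0"
    and \<sigma>: "norm \<sigma> = 1"
    and lim: "((\<lambda>z. (\<sigma> - z) * H z) \<longlongrightarrow> e) (at \<sigma> within unit_disc)"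
    and max: "\<And>\<delta>. (\<And>z. z \<in> unit_disc \<Longrightarrow> \<delta> * Re (herglotz_kernel \<sigma> z) \<le> Re (H z)) \<Longrightarrow> \<delta> \<le> 0"
  shows "e = 0"
proof -
  have \<sigma>0: "\<sigma> \<noteq> 0" using \<sigma> by auto
  define e' where "e' = e / \<sigma>"
  have ray: "((\<lambda>\<rho>. of_real \<rho> * H ((1 - of_real \<rho> * u) * \<sigma>)) \<longlongrightarrow> e' / u) (at_right (0::real))"
    "Re (e' / u) \<ge> 0"
    if u: "Re u = 1" "(norm u)\<^sup>2 \<le> 2" for u
  proof -
    let ?z = "\<lambda>\<rho>::real. (1 - of_real \<rho> * u) * \<sigma>"
    have u0: "u \<noteq> 0" using u by auto
    have ev01: "\<forall>\<^sub>F \<rho> in at_right (0::real). 0 < \<rho> \<and> \<rho> < 1"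
      using eventually_at_right_field[of "\<lambda>r. 0 < r \<and> r < 1" "0::real"] by (auto intro: exI[of _ 1])
    have inD: "?z \<rho> \<in> unit_disc" if "0 < \<rho>" "\<rho> < 1" for \<rho>
    proof -
      have "(norm (1 - of_real \<rho> * u))\<^sup>2 = 1 - 2 * \<rho> + \<rho>\<^sup>2 * (norm u)\<^sup>2"
        using u(1) unfolding cmod_power2 by (simp add: power2_eq_square algebra_simps)
      also have "\<dots> \<le> 1 - 2 * \<rho> + \<rho>\<^sup>2 * 2" using u(2) by (simp add: mult_left_mono)
      also have "\<dots> < 1" using that by (simp add: power2_eq_square)
      finally show ?thesis using \<sigma> by (simp add: norm_mult power_less_one_iff)
    qed
    have "(?z \<longlongrightarrow> \<sigma>) (at_right 0)" by (rule tendsto_eq_intros refl)+ simp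
    moreover have "\<forall>\<^sub>F \<rho> in at_right 0. ?z \<rho> \<in> unit_disc \<and> ?z \<rho> \<noteq> \<sigma>"
      using ev01 by eventually_elim (use inD \<sigma> in force)
    ultimately have "filterlim ?z (at \<sigma> within unit_disc) (at_right 0)"
      by (simp add: filterlim_at)
    from filterlim_compose[OF lim this]
    have "((\<lambda>\<rho>. (\<sigma> - ?z \<rho>) * H (?z \<rho>) / (u * \<sigma>)) \<longlongrightarrow> e / (u * \<sigma>)) (at_right 0)"
      using u0 \<sigma>0 by (intro tendsto_intros) auto
    moreover have "(\<sigma> - ?z \<rho>) * H (?z \<rho>) / (u * \<sigma>) = of_real \<rho> * H (?z \<rho>)" for \<rho>
      using u0 \<sigma>0 by (simp add: field_simps)
    moreover have "e / (u * \<sigma>) = e' / u" by (simp add: e'_def mult.commute)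
    ultimately show L: "((\<lambda>\<rho>. of_real \<rho> * H (?z \<rho>)) \<longlongrightarrow> e' / u) (at_right 0)" by simp
    have "\<forall>\<^sub>F \<rho> in at_right 0. 0 \<le> Re (of_real \<rho> * H (?z \<rho>))"
      using ev01 by eventually_elim (use inD pos in auto)
    then show "Re (e' / u) \<ge> 0"
      using tendsto_lowerbound[OF tendsto_Re[OF L]] by simp
  qed
  have "Re e' / 2 \<le> 0"
  proof (rule max)
    fix z assume z: "z \<in> unit_disc"
    have "((\<lambda>\<rho>. of_real \<rho> * H ((1 - of_real \<rho>) * \<sigma>)) \<longlongrightarrow> e') (at_right (0::real))"
      using ray(1)[of 1] by simp
    moreover have "filterlim (\<lambda>r::real. 1 - r) (at_right 0) (at_left 1)"
      unfolding filterlim_at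
      by (auto intro!: tendsto_eq_intros simp: eventually_at_filter)
    ultimately have "((\<lambda>r. of_real (1 - r) * H ((1 - of_real (1 - r)) * \<sigma>)) \<longlongrightarrow> e') (at_left (1::real))"
      by (rule filterlim_compose)
    then have "((\<lambda>r. of_real (1 - r) * H (of_real r * \<sigma>)) \<longlongrightarrow> e') (at_left (1::real))" by simp
    from tendsto_Re[OF this]
    have "((\<lambda>r. (1 - r) * Re (H (of_real r * \<sigma>))) \<longlongrightarrow> Re e') (at_left (1::real))" by simp
    then have "((\<lambda>r. 1 / (1 + r) * ((1 - r) * Re (H (of_real r * \<sigma>)))) \<longlongrightarrow> 1 / (1 + 1) * Re e') (at_left (1::real))"
      by (intro tendsto_intros) auto
    then have q: "((\<lambda>r. (1 - r) / (1 + r) * Re (H (of_real r * \<sigma>))) \<longlongrightarrow> Re e' / 2) (at_left (1::real))"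
      by simp
    show "Re e' / 2 * Re (herglotz_kernel \<sigma> z) \<le> Re (H z)"
      by (rule julia_halfplane[OF hol pos \<sigma> q _ z]) auto
  qed
  moreover have "Re (e' / 1) \<ge> 0" by (rule ray(2)) auto
  moreover have "Re (e' / (1 + \<i>)) \<ge> 0" "Re (e' / (1 - \<i>)) \<ge> 0"
    by (rule ray(2); simp add: cmod_power2)+
  ultimately have "e' = 0" by (simp add: complex_eq_iff Re_divide)
  then show ?thesis using \<sigma>0 by (simp add: e'_def)
qed

lemma poly_eq_smult_prod_roots:
  fixes p :: "complex poly"
  assumes "finite J" "inj_on \<sigma> J" "degree p \<le> card J" "\<And>j. j \<in> J \<Longrightarrow> poly p (\<sigma> j) = 0"
  shows "\<exists>K. p = smult K (\<Prod>j\<in>J. [:- \<sigma> j, 1:])"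
  using assms
proof (induction J arbitrary: p rule: finite_induct)
  case empty
  then obtain a where "p = [:a:]" using degree_eq_zeroE[of p] by auto
  then show ?case by (intro exI[of _ a]) simp
next
  case (insert i J)
  have "[:- \<sigma> i, 1:] dvd p" using insert.prems(3)[of i] by (simp add: poly_eq_0_iff_dvd)
  then obtain q where q: "p = [:- \<sigma> i, 1:] * q" by (elim dvdE)
  have "degree q \<le> card J"
  proof (cases "q = 0")
    case False
    then have "degree p = 1 + degree q" unfolding q by (subst degree_mult_eq) auto
    then show ?thesis using insert.prems(2) insert.hyps by simp
  qed simp
  moreover have "poly q (\<sigma> j) = 0" if "j \<in> J" for j
  proof -
    have "\<sigma> j \<noteq> \<sigma> i" using insert.prems(1) insert.hyps that by (auto simp: inj_on_def)
    then show ?thesis using insert.prems(3)[of j] that by (simp add: q)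
  qed
  ultimately obtain K where "q = smult K (\<Prod>j\<in>J. [:- \<sigma> j, 1:])"
    using insert.IH insert.prems(1) by auto
  then have "p = smult K (\<Prod>j\<in>insert i J. [:- \<sigma> j, 1:])"
    unfolding q by (simp only: prod.insert[OF insert.hyps(1,2)] mult_smult_right)
  then show ?case by blast
qed

lemma tendsto_poly_radius:
  "((\<lambda>r. poly p (of_real r * \<sigma>)) \<longlongrightarrow> poly p (\<sigma>::complex)) (at_left (1::real))"
  by (intro tendsto_poly tendsto_radius)

lemma degree_prod_le_card:
  assumes "finite I" "\<And>i. i \<in> I \<Longrightarrow> degree (f i) \<le> 1"
  shows "degree (\<Prod>i\<in>I. f i) \<le> card I"
  using degree_prod_sum_le[OF assms(1), of f] sum_bounded_above[of I "\<lambda>i. degree (f i)" 1] assms(2)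
  by (simp add: o_def)

text \<open>
  The converse to \<open>herglotz_sum_cayley_blaschke\<close>: a Blaschke product of degree \<open>n\<close> that takes the value
  \<open>1\<close> at \<open>n\<close> points of the circle has all its mass there. If \<open>g = A / B\<close>, then \<open>h\<close> has the denominator
  \<open>W = B - A\<close>, whose degree is at most \<open>n\<close>, so that its zeros are exactly the \<open>\<sigma> j\<close>, all simple. The
  difference \<open>H\<close> of \<open>h\<close> and its kernels is \<open>R / W\<close> with \<open>deg R \<le> n\<close>. Since the \<open>c j\<close> are the full masses,
  \<open>H\<close> has no pole, so \<open>R\<close> vanishes at every \<open>\<sigma> j\<close> too and \<open>H\<close> is constant. The constant is imaginary
  because \<open>\<bar>g\<bar> = 1\<close> on the circle.
\<close>

lemma blaschke_cayley_total_mass: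
  fixes \<sigma> :: "'i \<Rightarrow> complex"
  assumes J: "finite J" and inj: "inj_on \<sigma> J"
    and \<sigma>: "\<And>j. j \<in> J \<Longrightarrow> norm (\<sigma> j) = 1" and c: "\<And>j. j \<in> J \<Longrightarrow> c j > 0"
    and blaschke: "blaschke_product (card J) g"
    and g1: "\<And>z. z \<in> unit_disc \<Longrightarrow> norm (g z) < 1"
    and glim: "\<And>j. j \<in> J \<Longrightarrow> ((\<lambda>r. g (of_real r * \<sigma> j)) \<longlongrightarrow> 1) (at_left (1::real))"
    and h: "\<And>z. z \<in> unit_disc \<Longrightarrow> h z = (1 + g z) / (1 - g z)"
    and hol: "h holomorphic_on unit_disc"
    and le: "\<And>j z. j \<in> J \<Longrightarrow> z \<in> unit_disc \<Longrightarrow> c j * Re (herglotz_kernel (\<sigma> j) z) \<le> Re (h z)"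
    and max: "\<And>j d. j \<in> J \<Longrightarrow> (\<And>z. z \<in> unit_disc \<Longrightarrow> d * Re (herglotz_kernel (\<sigma> j) z) \<le> Re (h z)) \<Longrightarrow> d \<le> c j"
  shows "Re (h 0) = (\<Sum>j\<in>J. c j)"
proof -
  define n where "n = card J"
  obtain \<theta> a where a: "\<And>i. i \<in> {1..n} \<Longrightarrow> a i \<in> unit_disc"
    and g: "\<And>z. z \<in> unit_disc \<Longrightarrow> g z = cis \<theta> * (\<Prod>i=1..n. (z - a i) / (1 - cnj (a i) * z))"
    using blaschke unfolding blaschke_product_def n_def by blast
  define A where "A = smult (cis \<theta>) (\<Prod>i=1..n. [:- a i, 1:])"
  define B where "B = (\<Prod>i=1..n. [:1, - cnj (a i):])"
  define W where "W = B - A"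
  have polyA: "poly A z = cis \<theta> * (\<Prod>i=1..n. z - a i)" for z by (simp add: A_def poly_prod)
  have polyB: "poly B z = (\<Prod>i=1..n. 1 - cnj (a i) * z)" for z by (simp add: B_def poly_prod mult.commute)
  have degAB: "degree A \<le> n" "degree B \<le> n"
    unfolding A_def B_def
    using degree_prod_le_card[of "{1..n}" "\<lambda>i. [:- a i, 1:]"]
      degree_prod_le_card[of "{1..n}" "\<lambda>i. [:1, - cnj (a i):]"]
    by simp_all
  have B0: "poly B z \<noteq> 0" if "z \<in> unit_disc" for z
    unfolding polyB using a disc_automorphism_in_disc(1)[OF that] by (subst prod_zero_iff) auto
  have gAB: "poly A z = g z * poly B z" if "z \<in> unit_disc" for z
    using B0[OF that] by (simp add: g[OF that] polyA polyB prod_dividef)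
  have g1': "1 - g z \<noteq> 0" if "z \<in> unit_disc" for z using g1[OF that] by auto
  have W: "poly W z = (1 - g z) * poly B z" if "z \<in> unit_disc" for z
    using gAB[OF that] by (simp add: W_def algebra_simps)
  have hW: "h z * poly W z = poly (A + B) z" if "z \<in> unit_disc" for z
  proof -
    have "h z * poly W z = (1 + g z) * poly B z"
      using g1'[OF that] by (simp add: h[OF that] W[OF that])
    then show ?thesis by (simp add: gAB[OF that] distrib_right add.commute)
  qed
  have Wnode: "poly W (\<sigma> j) = 0" if "j \<in> J" for j
  proof -
    have "((\<lambda>r. (1 - g (of_real r * \<sigma> j)) * poly B (of_real r * \<sigma> j)) \<longlongrightarrow> (1 - 1) * poly B (\<sigma> j)) (at_left (1::real))"
      by (intro tendsto_intros glim that tendsto_poly_radius)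
    moreover have "\<forall>\<^sub>F r in at_left (1::real). (1 - g (of_real r * \<sigma> j)) * poly B (of_real r * \<sigma> j) = poly W (of_real r * \<sigma> j)"
      using eventually_radius by eventually_elim (use W radius_in_disc[OF \<sigma>[OF that]] in auto)
    ultimately have "((\<lambda>r. poly W (of_real r * \<sigma> j)) \<longlongrightarrow> (1 - 1) * poly B (\<sigma> j)) (at_left (1::real))"
      by (rule Lim_transform_eventually)
    from tendsto_unique[OF _ this tendsto_poly_radius] show ?thesis by simp
  qed
  have "degree W \<le> card J" unfolding W_def using degAB by (intro degree_diff_le) (auto simp: n_def)
  then obtain K where K: "W = smult K (\<Prod>j\<in>J. [:- \<sigma> j, 1:])"
    using poly_eq_smult_prod_roots[OF J inj _ Wnode] by blast
  have polyW: "poly W z = K * (\<Prod>j\<in>J. z - \<sigma> j)" for z by (simp add: K poly_prod)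
  have "poly W 0 \<noteq> 0" using W[of 0] g1'[of 0] B0[of 0] by simp
  then have K0: "K \<noteq> 0" by (auto simp: polyW)
  define H where "H = (\<lambda>z. h z - (\<Sum>j\<in>J. of_real (c j) * herglotz_kernel (\<sigma> j) z))"
  define R where "R = A + B - smult K (herglotz_numerator c \<sigma> J)"
  have degR: "degree R \<le> card J"
    unfolding R_def using degAB degree_herglotz_numerator_le[OF J, of c \<sigma>]
      order_trans[OF degree_smult_le, of "herglotz_numerator c \<sigma> J" "card J" K]
    by (intro degree_diff_le degree_add_le) (auto simp: n_def)
  have outside: "z \<notin> \<sigma> ` J" if "z \<in> unit_disc" for z using that \<sigma> by auto
  have R: "poly R z = H z * poly W z" if z: "z \<in> unit_disc" for z
    using hW[OF z] poly_herglotz_numerator[OF J outside[OF z], of c]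
    by (simp add: R_def H_def polyW left_diff_distrib)
  have holH: "H holomorphic_on unit_disc"
    unfolding H_def using \<sigma> by (intro holomorphic_intros hol herglotz_kernel_holomorphic) auto
  have posh: "Re (h z) \<ge> 0" if z: "z \<in> unit_disc" for z
    unfolding h[OF z] by (rule less_imp_le[OF cayley_pos[OF g1[OF z]]])
  have posH: "Re (H z) \<ge> 0" if "z \<in> unit_disc" for z
    using herglotz_minorants_add[OF hol J inj \<sigma> posh le that] by (simp add: H_def)
  \<comment> \<open>The limit of \<open>(\<sigma> j - z) * H z\<close> is a nonzero multiple of \<open>poly R (\<sigma> j)\<close>.\<close>
  have Rnode: "poly R (\<sigma> j) = 0" if j: "j \<in> J" for j
  proof -
    let ?d = "\<lambda>z. - (K * (\<Prod>i\<in>J - {j}. z - \<sigma> i))"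
    have d0: "?d (\<sigma> j) \<noteq> 0" using K0 inj j J by (auto simp: inj_on_def)
    have "((\<lambda>z. poly R z / ?d z) \<longlongrightarrow> poly R (\<sigma> j) / ?d (\<sigma> j)) (at (\<sigma> j) within unit_disc)"
      using d0 by (intro tendsto_intros tendsto_poly) auto
    moreover have "\<forall>\<^sub>F z in at (\<sigma> j) within unit_disc. poly R z / ?d z = (\<sigma> j - z) * H z"
    proof -
      have "poly R z / ?d z = (\<sigma> j - z) * H z" if z: "z \<in> unit_disc" for z
      proof -
        have split: "(\<Prod>i\<in>J. z - \<sigma> i) = (z - \<sigma> j) * (\<Prod>i\<in>J - {j}. z - \<sigma> i)"
          using J j by (rule prod.remove)
        have "poly R z = (\<sigma> j - z) * H z * ?d z"
          unfolding R[OF z] polyW split by (simp add: algebra_simps)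
        moreover have "?d z \<noteq> 0" using outside[OF z] K0 J by auto
        ultimately show ?thesis by (metis nonzero_mult_div_cancel_right)
      qed
      then show ?thesis by (simp add: eventually_at_filter)
    qed
    ultimately have lim: "((\<lambda>z. (\<sigma> j - z) * H z) \<longlongrightarrow> poly R (\<sigma> j) / ?d (\<sigma> j)) (at (\<sigma> j) within unit_disc)"
      by (rule Lim_transform_eventually)
    have "poly R (\<sigma> j) / ?d (\<sigma> j) = 0"
    proof (rule nonneg_Re_pole_coefficient_eq_0[OF holH posH \<sigma>[OF j] lim])
      fix \<delta> assume \<delta>: "\<And>z. z \<in> unit_disc \<Longrightarrow> \<delta> * Re (herglotz_kernel (\<sigma> j) z) \<le> Re (H z)"
      have "(c j + \<delta>) * Re (herglotz_kernel (\<sigma> j) z) \<le> Re (h z)" if z: "z \<in> unit_disc" for z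
      proof -
        have "c j * Re (herglotz_kernel (\<sigma> j) z) \<le> (\<Sum>i\<in>J. c i * Re (herglotz_kernel (\<sigma> i) z))"
          using J j c Re_herglotz_kernel_pos[OF \<sigma> z]
          by (intro member_le_sum) (auto simp: less_imp_le)
        then show ?thesis using \<delta>[OF z] by (simp add: H_def algebra_simps)
      qed
      from max[OF j this] show "\<delta> \<le> 0" by simp
    qed
    then show ?thesis using d0 by simp
  qed
  obtain E where E: "R = smult E (\<Prod>j\<in>J. [:- \<sigma> j, 1:])"
    using poly_eq_smult_prod_roots[OF J inj degR Rnode] by blast
  have H: "H z = E / K" if z: "z \<in> unit_disc" for z
  proof -
    have "(\<Prod>j\<in>J. z - \<sigma> j) \<noteq> 0" using outside[OF z] J by auto
    moreover have "E * (\<Prod>j\<in>J. z - \<sigma> j) = H z * (K * (\<Prod>j\<in>J. z - \<sigma> j))"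
      using R[OF z] unfolding polyW by (simp add: E poly_prod)
    ultimately show ?thesis using K0 by (simp add: field_simps)
  qed
  have Reh: "Re (h z) = Re (E / K) + (\<Sum>j\<in>J. c j * Re (herglotz_kernel (\<sigma> j) z))" if "z \<in> unit_disc" for z
    using arg_cong[OF H[OF that], of Re] by (simp add: H_def)
  have "Re (E / K) = 0"
  proof -
    have "sphere 0 1 - \<sigma> ` J \<noteq> {}"
      by (intro infinite_imp_nonempty infinite_circle_minus_finite finite_imageI J)
    then obtain \<zeta> where "\<zeta> \<in> sphere 0 1 - \<sigma> ` J" by blast
    then have \<zeta>: "norm \<zeta> = 1" "\<zeta> \<notin> \<sigma> ` J" by simp_all
    \<comment> \<open>The formula for \<open>Re h\<close> without denominators, which extends to a boundary point \<open>\<zeta>\<close>.\<close>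
    let ?l = "\<lambda>z. (norm (poly B z))\<^sup>2 - (norm (poly A z))\<^sup>2"
    let ?r = "\<lambda>z. (norm (poly W z))\<^sup>2 * (Re (E / K) + (\<Sum>j\<in>J. c j * Re (herglotz_kernel (\<sigma> j) z)))"
    have "?l z = ?r z" if z: "z \<in> unit_disc" for z
    proof -
      have "poly W z \<noteq> 0" using W[OF z] g1'[OF z] B0[OF z] by simp
      then have "h z = (poly B z + poly A z) / (poly B z - poly A z)"
        using hW[OF z] by (simp add: W_def field_simps)
      then have "Re (h z) = ?l z / (norm (poly B z - poly A z))\<^sup>2"
        unfolding cmod_power2 by (simp add: Re_divide power2_eq_square algebra_simps)
      then show ?thesis using Reh[OF z] \<open>poly W z \<noteq> 0\<close> by (simp add: W_def field_simps)
    qed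
    then have "?l (of_real r * \<zeta>) = ?r (of_real r * \<zeta>)" if "0 < r \<and> r < 1" for r
      using that radius_in_disc[OF \<zeta>(1)] by blast
    then have ev: "\<forall>\<^sub>F r in at_left (1::real). ?l (of_real r * \<zeta>) = ?r (of_real r * \<zeta>)"
      by (rule eventually_mono[OF eventually_radius])
    have l: "((\<lambda>r. ?l (of_real r * \<zeta>)) \<longlongrightarrow> ?l \<zeta>) (at_left (1::real))"
      by (intro tendsto_intros tendsto_poly_radius)
    have r: "((\<lambda>r. ?r (of_real r * \<zeta>)) \<longlongrightarrow> ?r \<zeta>) (at_left (1::real))"
      unfolding herglotz_kernel_def using \<zeta> by (intro tendsto_intros tendsto_poly_radius tendsto_radius) auto
    have "?l \<zeta> = ?r \<zeta>"
      using tendsto_unique[OF _ Lim_transform_eventually[OF l ev] r] by simp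
    moreover have "?l \<zeta> = 0"
    proof -
      have "norm (\<zeta> - a i) = norm (1 - cnj (a i) * \<zeta>)" for i
        using circle_linear_reflection[OF \<zeta>(1), of "a i"] \<zeta>(1)
        by (metis complex_mod_cnj mult_1 norm_mult)
      then show ?thesis by (simp add: polyA polyB norm_mult prod_norm[symmetric])
    qed
    moreover have "poly W \<zeta> \<noteq> 0" using \<zeta> K0 J by (auto simp: polyW)
    ultimately show ?thesis using Re_herglotz_kernel_circle[OF \<sigma> \<zeta>(1)] by simp
  qed
  moreover have "Re (herglotz_kernel (\<sigma> j) 0) = 1" if "j \<in> J" for j
    using \<sigma>[OF that] by (simp add: Re_herglotz_kernel)
  ultimately show ?thesis using Reh[of 0] by simp
qed

section \<open>Boundary dilation as reciprocal mass\<close>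

lemma cayley_holomorphic:
  assumes "g holomorphic_on unit_disc" "\<And>z. z \<in> unit_disc \<Longrightarrow> norm (g z) < 1"
  shows "(\<lambda>z. (1 + g z) / (1 - g z)) holomorphic_on unit_disc"
  using assms by (intro holomorphic_intros) force+

lemma schwarz_pick_disc:
  assumes hol: "g holomorphic_on unit_disc"
    and g: "\<And>z. z \<in> unit_disc \<Longrightarrow> norm (g z) < 1"
    and z: "z \<in> unit_disc" and w: "w \<in> unit_disc"
  shows "(1 - (norm z)\<^sup>2) * (1 - (norm w)\<^sup>2) * (norm (1 - cnj (g w) * g z))\<^sup>2
           \<le> (1 - (norm (g z))\<^sup>2) * (1 - (norm (g w))\<^sup>2) * (norm (1 - cnj w * z))\<^sup>2"
proof -
  have nz: "1 - g z \<noteq> 0" "1 - g w \<noteq> 0" using g[OF z] g[OF w] by auto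
  then have nz': "1 - cnj (g w) \<noteq> 0" by (metis complex_cnj_diff complex_cnj_one complex_cnj_zero_iff)
  define p where "p = (norm (1 - g z))\<^sup>2 * (norm (1 - g w))\<^sup>2"
  have p: "p > 0" using nz by (simp add: p_def)
  have "(1 + g z) / (1 - g z) + cnj ((1 + g w) / (1 - g w))
      = 2 * (1 - cnj (g w) * g z) / ((1 - g z) * cnj (1 - g w))"
    using nz nz' by (simp add: field_simps)
  then have "norm ((1 + g z) / (1 - g z) + cnj ((1 + g w) / (1 - g w)))
      = 2 * norm (1 - cnj (g w) * g z) / (norm (1 - g z) * norm (1 - g w))"
    by (metis complex_mod_cnj norm_divide norm_mult norm_numeral)
  then have sq: "(norm ((1 + g z) / (1 - g z) + cnj ((1 + g w) / (1 - g w))))\<^sup>2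
      = 4 * (norm (1 - cnj (g w) * g z))\<^sup>2 / p"
    by (simp add: p_def power_divide power_mult_distrib)
  have Re: "Re ((1 + g z) / (1 - g z)) * Re ((1 + g w) / (1 - g w))
      = (1 - (norm (g z))\<^sup>2) * (1 - (norm (g w))\<^sup>2) / p"
    by (simp only: Re_cayley p_def times_divide_times_eq)
  have "(1 - (norm z)\<^sup>2) * (1 - (norm w)\<^sup>2) * (4 * (norm (1 - cnj (g w) * g z))\<^sup>2 / p)
      \<le> 4 * ((1 - (norm (g z))\<^sup>2) * (1 - (norm (g w))\<^sup>2) / p) * (norm (1 - cnj w * z))\<^sup>2"
    using schwarz_pick_halfplane_Re[OF cayley_holomorphic[OF hol g] less_imp_le[OF cayley_pos[OF g]] z w]
    unfolding sq by (simp only: mult.assoc Re[unfolded mult.assoc])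
  moreover have "a * b \<le> c * e" if "a * (4 * b / p) \<le> 4 * (c / p) * e" for a b c e :: real
    using that p by (simp add: field_simps)
  ultimately show ?thesis by blast
qed

lemma norm_diff_radius:
  assumes "norm (\<sigma>::complex) = 1"
  shows "norm (\<sigma> - of_real r * \<sigma>) = \<bar>1 - r\<bar>"
proof -
  have "\<sigma> - of_real r * \<sigma> = of_real (1 - r) * \<sigma>" by (simp add: algebra_simps)
  then show ?thesis using assms by (simp only: norm_mult norm_of_real mult_1_right)
qed

text \<open>
  With \<open>x = \<bar>z\<bar>\<close> and \<open>y = \<bar>g z\<bar>\<close> this relates the quotients of \<open>z ^ k * g z\<close> and of \<open>g\<close>: as \<open>x \<rightarrow> 1\<close> the
  sum tends to \<open>k\<close>, so multiplication by \<open>z ^ k\<close> raises the boundary dilation by \<open>k\<close>.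
\<close>

lemma dilation_quotient_power:
  fixes x y :: real
  assumes "x < 1"
  shows "(1 - x ^ k * y) / (1 - x) = (\<Sum>i<k. x ^ i) + x ^ k * ((1 - y) / (1 - x))"
proof -
  have "1 - x ^ k * y = (1 - x) * (\<Sum>i<k. x ^ i) + x ^ k * (1 - y)"
    using one_diff_power_eq[of x k] by (simp add: right_diff_distrib)
  then show ?thesis using assms by (simp add: add_divide_distrib)
qed

text \<open>
  The dilation is a lower limit over arbitrary approach to \<open>\<sigma>\<close>, so the extremal sequence \<open>v\<close> says
  nothing in advance about the radial limit of \<open>g\<close>. By compactness \<open>g (v m)\<close> may be assumed to converge to
  some \<open>\<tau>\<close>, the dilation bound forces \<open>\<bar>\<tau>\<bar> = 1\<close>, and the Schwarz-Pick inequality with \<open>w = v m\<close> yields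
  Julia's inequality with \<open>\<tau>\<close> in place of \<open>1\<close>. On the radius that inequality makes \<open>g\<close> tend to \<open>\<tau>\<close>, whence
  \<open>\<tau> = 1\<close>.
\<close>

lemma julia_from_boundary_dilation:
  fixes b :: real
  assumes hol: "g holomorphic_on unit_disc"
    and g: "\<And>z. z \<in> unit_disc \<Longrightarrow> norm (g z) < 1"
    and f: "\<And>z. z \<in> unit_disc \<Longrightarrow> f z = z ^ k * g z"
    and \<sigma>: "norm \<sigma> = 1"
    and glim: "((\<lambda>r. g (of_real r * \<sigma>)) \<longlongrightarrow> 1) (at_left (1::real))"
    and b: "boundary_dilation f \<sigma> < ereal b"
    and z: "z \<in> unit_disc"
  shows "Re (herglotz_kernel \<sigma> z) \<le> (b - real k) * Re ((1 + g z) / (1 - g z))"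
proof -
  let ?F = "\<lambda>w. (1 - norm (f w)) / (1 - norm w)"
  have "\<exists>w. w \<in> unit_disc \<and> dist w \<sigma> < 1 / real (Suc m) \<and> ?F w < b" for m
  proof (rule ccontr)
    assume "\<not> ?thesis"
    then have "\<forall>w\<in>unit_disc. w \<noteq> \<sigma> \<and> dist w \<sigma> < 1 / real (Suc m) \<longrightarrow> ereal b \<le> ereal (?F w)"
      by (force simp: not_less)
    then have "\<forall>\<^sub>F w in at \<sigma> within unit_disc. ereal b \<le> ereal (?F w)"
      unfolding eventually_at by (intro exI[of _ "1 / real (Suc m)"]) simp
    from Liminf_bounded[OF this] b show False by (simp add: boundary_dilation_def)
  qed
  then obtain w where w: "\<And>m. w m \<in> unit_disc" "\<And>m. dist (w m) \<sigma> < 1 / real (Suc m)" "\<And>m. ?F (w m) < b"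
    by metis
  have wlim: "w \<longlonglongrightarrow> \<sigma>"
  proof (rule tendsto_dist_iff[THEN iffD2])
    have lim0: "(\<lambda>m. 1 / real (Suc m)) \<longlonglongrightarrow> 0" using LIMSEQ_inverse_real_of_nat by (simp add: inverse_eq_divide)
    have "norm (dist (w m) \<sigma>) \<le> 1 / real (Suc m)" for m
      using w(2)[of m] by (simp del: of_nat_Suc)
    then have "\<forall>\<^sub>F m in sequentially. norm (dist (w m) \<sigma>) \<le> 1 / real (Suc m)" by (rule always_eventually[OF allI])
    then show "(\<lambda>m. dist (w m) \<sigma>) \<longlonglongrightarrow> 0" by (rule Lim_null_comparison[OF _ lim0])
  qed
  have "g (w m) \<in> cball 0 1" for m using g[OF w(1)] by (simp add: less_imp_le)
  then obtain \<tau> \<phi> where \<phi>: "strict_mono \<phi>" and \<tau>: "((\<lambda>m. g (w m)) \<circ> \<phi>) \<longlonglongrightarrow> \<tau>"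
    using compact_imp_seq_compact[OF compact_cball] seq_compactE by (metis (no_types, lifting))
  define v where "v = w \<circ> \<phi>"
  have v: "v m \<in> unit_disc" "?F (v m) < b" for m using w by (auto simp: v_def)
  have vlim: "v \<longlonglongrightarrow> \<sigma>" unfolding v_def by (rule LIMSEQ_subseq_LIMSEQ[OF wlim \<phi>])
  have gv: "(\<lambda>m. g (v m)) \<longlonglongrightarrow> \<tau>" using \<tau> by (simp add: v_def o_def)
  let ?s = "\<lambda>m. \<Sum>i<k. norm (v m) ^ i"
  have nv: "(\<lambda>m. norm (v m)) \<longlonglongrightarrow> 1" using tendsto_norm[OF vlim] \<sigma> by simp
  have "?s \<longlonglongrightarrow> (\<Sum>i<k. 1 ^ i)" by (intro tendsto_intros nv)
  then have slim: "?s \<longlonglongrightarrow> real k" by simp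
  \<comment> \<open>Denominators are cleared so that \<open>v m = 0\<close> needs no separate treatment.\<close>
  have key: "norm (v m) ^ k * (1 - norm (g (v m))) \<le> (b - ?s m) * (1 - norm (v m))" for m
  proof -
    have lt: "norm (v m) < 1" using v(1)[of m] by simp
    have "?F (v m) = ?s m + norm (v m) ^ k * ((1 - norm (g (v m))) / (1 - norm (v m)))"
      using dilation_quotient_power[OF lt, of k "norm (g (v m))"]
      by (simp add: f[OF v(1)] norm_mult norm_power)
    with v(2)[of m] have "norm (v m) ^ k * (1 - norm (g (v m))) / (1 - norm (v m)) \<le> b - ?s m" by simp
    then show ?thesis using lt by (simp add: pos_divide_le_eq)
  qed
  have L: "(\<lambda>m. norm (v m) ^ k * (1 - norm (g (v m)))) \<longlonglongrightarrow> 1 ^ k * (1 - norm \<tau>)"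
    by (intro tendsto_intros nv gv)
  have R: "(\<lambda>m. (b - ?s m) * (1 - norm (v m))) \<longlonglongrightarrow> (b - real k) * (1 - 1)"
    by (intro tendsto_intros nv slim)
  have "1 ^ k * (1 - norm \<tau>) \<le> (b - real k) * (1 - 1)"
    by (rule tendsto_le[OF sequentially_bot R L always_eventually[OF allI[OF key]]])
  moreover have "norm \<tau> \<le> 1"
    by (rule tendsto_upperbound[OF tendsto_norm[OF gv] always_eventually[OF allI[OF less_imp_le[OF g[OF v(1)]]]]]) simp
  ultimately have \<tau>1: "norm \<tau> = 1" by simp
  have pick: "(1 - (norm z)\<^sup>2) * (norm (1 - cnj \<tau> * g z))\<^sup>2
      \<le> (b - real k) * (1 - (norm (g z))\<^sup>2) * (norm (1 - cnj \<sigma> * z))\<^sup>2" if z: "z \<in> unit_disc" for z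
  proof -
    let ?X = "\<lambda>m. (1 + norm (v m)) * (1 - (norm z)\<^sup>2) * (norm (1 - cnj (g (v m)) * g z))\<^sup>2 * norm (v m) ^ k"
    let ?Y = "\<lambda>m. (1 + norm (g (v m))) * (b - ?s m) * (1 - (norm (g z))\<^sup>2) * (norm (1 - cnj (v m) * z))\<^sup>2"
    have ev: "?X m \<le> ?Y m" for m
    proof -
      have lt: "norm (v m) < 1" "norm (g z) < 1" using v(1)[of m] g[OF z] by auto
      have "(1 - norm (v m)) * ?X m
          = (1 - (norm z)\<^sup>2) * (1 - (norm (v m))\<^sup>2) * (norm (1 - cnj (g (v m)) * g z))\<^sup>2 * norm (v m) ^ k"
        by (simp add: power2_eq_square[of "norm (v m)"] algebra_simps)
      also have "\<dots> \<le> (1 - (norm (g z))\<^sup>2) * (1 - (norm (g (v m)))\<^sup>2) * (norm (1 - cnj (v m) * z))\<^sup>2 * norm (v m) ^ k"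
        by (intro mult_right_mono schwarz_pick_disc[OF hol g z v(1)]) auto
      also have "\<dots> = (1 + norm (g (v m))) * (1 - (norm (g z))\<^sup>2) * (norm (1 - cnj (v m) * z))\<^sup>2
          * (norm (v m) ^ k * (1 - norm (g (v m))))"
        by (simp add: power2_eq_square[of "norm (g (v m))"] algebra_simps)
      also have "\<dots> \<le> (1 + norm (g (v m))) * (1 - (norm (g z))\<^sup>2) * (norm (1 - cnj (v m) * z))\<^sup>2
          * ((b - ?s m) * (1 - norm (v m)))"
        using lt by (intro mult_left_mono key) (auto simp: power_le_one)
      also have "\<dots> = (1 - norm (v m)) * ?Y m" by (simp only: mult_ac)
      finally show ?thesis using lt by simp
    qed
    have X: "?X \<longlonglongrightarrow> (1 + 1) * (1 - (norm z)\<^sup>2) * (norm (1 - cnj \<tau> * g z))\<^sup>2 * 1 ^ k"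
      by (intro tendsto_intros nv gv)
    have Y: "?Y \<longlonglongrightarrow> (1 + norm \<tau>) * (b - real k) * (1 - (norm (g z))\<^sup>2) * (norm (1 - cnj \<sigma> * z))\<^sup>2"
      by (intro tendsto_intros gv slim vlim)
    have "(1 + 1) * (1 - (norm z)\<^sup>2) * (norm (1 - cnj \<tau> * g z))\<^sup>2 * 1 ^ k
      \<le> (1 + norm \<tau>) * (b - real k) * (1 - (norm (g z))\<^sup>2) * (norm (1 - cnj \<sigma> * z))\<^sup>2"
      by (rule tendsto_le[OF sequentially_bot Y X always_eventually[OF allI[OF ev]]])
    then show ?thesis by (simp only: \<tau>1 power_one mult_1_right mult.assoc) simp
  qed
  have norm_refl: "norm (1 - cnj \<sigma> * z) = norm (\<sigma> - z)" for z
  proof -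
    have "cnj \<sigma> * (\<sigma> - z) = 1 - cnj \<sigma> * z"
      using circle_inverse[OF \<sigma>] by (simp add: algebra_simps)
    then show ?thesis using \<sigma> by (metis complex_mod_cnj mult_1 norm_mult)
  qed
  have "\<tau> = 1"
  proof -
    let ?X = "\<lambda>r. (1 + r) * (norm (1 - cnj \<tau> * g (of_real r * \<sigma>)))\<^sup>2"
    let ?Y = "\<lambda>r. (b - real k) * (1 - (norm (g (of_real r * \<sigma>)))\<^sup>2) * (1 - r)"
    have "?X r \<le> ?Y r" if r: "0 < r \<and> r < 1" for r
    proof -
      have d: "norm (\<sigma> - of_real r * \<sigma>) = 1 - r" using norm_diff_radius[OF \<sigma>] r by simp
      have nr: "norm (of_real r * \<sigma>) = r" using \<sigma> r by (simp add: norm_mult)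
      have "(1 - r\<^sup>2) * (norm (1 - cnj \<tau> * g (of_real r * \<sigma>)))\<^sup>2
        \<le> (b - real k) * (1 - (norm (g (of_real r * \<sigma>)))\<^sup>2) * (1 - r)\<^sup>2"
        using pick[OF radius_in_disc[OF \<sigma>, of r]] r unfolding norm_refl d nr by blast
      moreover have "1 - r\<^sup>2 = (1 - r) * (1 + r)" by (simp add: power2_eq_square algebra_simps)
      ultimately have "(1 - r) * ?X r \<le> (1 - r) * ?Y r"
        by (simp only: power2_eq_square[of "1 - r"] mult_ac)
      then show ?thesis using r by simp
    qed
    then have ev: "\<forall>\<^sub>F r in at_left 1. ?X r \<le> ?Y r" by (rule eventually_mono[OF eventually_radius])
    have X: "(?X \<longlongrightarrow> (1 + 1) * (norm (1 - cnj \<tau> * 1))\<^sup>2) (at_left 1)"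
      by (intro tendsto_intros glim)
    have Y: "(?Y \<longlongrightarrow> (b - real k) * (1 - (norm (1::complex))\<^sup>2) * (1 - 1)) (at_left 1)"
      by (intro tendsto_intros glim)
    have "(1 + 1) * (norm (1 - cnj \<tau> * 1))\<^sup>2 \<le> (b - real k) * (1 - (norm (1::complex))\<^sup>2) * (1 - 1)"
      by (rule tendsto_le[OF _ Y X ev]) simp
    then have "1 - cnj \<tau> = 0" by simp
    then show ?thesis by (metis complex_cnj_cnj complex_cnj_one eq_iff_diff_eq_0)
  qed
  moreover have "\<sigma> \<noteq> z" "g z \<noteq> 1" using \<sigma> z g[OF z] by auto
  ultimately show ?thesis
    using pick[OF z] unfolding norm_refl by (simp add: Re_cayley Re_herglotz_kernel[OF \<sigma>] field_simps)
qed

text \<open>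
  Evaluating Julia's inequality at \<open>0\<close> bounds \<open>b - k\<close> away from \<open>0\<close> for every \<open>b\<close> above the
  dilation; this keeps the dilation strictly above \<open>k\<close>, so that the mass \<open>1 / (\<beta> - k)\<close> is positive.
\<close>

lemma boundary_dilation_minorant:
  assumes hol: "g holomorphic_on unit_disc"
    and g: "\<And>z. z \<in> unit_disc \<Longrightarrow> norm (g z) < 1"
    and f: "\<And>z. z \<in> unit_disc \<Longrightarrow> f z = z ^ k * g z"
    and \<sigma>: "norm \<sigma> = 1"
    and glim: "((\<lambda>r. g (of_real r * \<sigma>)) \<longlongrightarrow> 1) (at_left (1::real))"
    and fin: "boundary_dilation f \<sigma> < \<infinity>"
  obtains \<beta> where "boundary_dilation f \<sigma> = ereal \<beta>" "\<beta> > real k"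
    "\<And>z. z \<in> unit_disc \<Longrightarrow> 1 / (\<beta> - real k) * Re (herglotz_kernel \<sigma> z) \<le> Re ((1 + g z) / (1 - g z))"
proof -
  have julia: "Re (herglotz_kernel \<sigma> z) \<le> (b - real k) * Re ((1 + g z) / (1 - g z))"
    if "boundary_dilation f \<sigma> < ereal b" "z \<in> unit_disc" for b z
    by (rule julia_from_boundary_dilation[OF hol g f \<sigma> glim that])
  define M where "M = Re ((1 + g 0) / (1 - g 0))"
  have M: "M > 0" unfolding M_def by (rule cayley_pos[OF g]) simp
  have lower: "ereal (real k + 1 / M) \<le> boundary_dilation f \<sigma>"
  proof (rule ccontr)
    assume "\<not> ?thesis"
    then obtain b where b: "boundary_dilation f \<sigma> < ereal b" "ereal b < ereal (real k + 1 / M)"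
      using ereal_dense2[of "boundary_dilation f \<sigma>" "ereal (real k + 1 / M)"] by (auto simp: not_le)
    have "Re (herglotz_kernel \<sigma> 0) = 1" using \<sigma> by (simp add: Re_herglotz_kernel)
    then have "1 \<le> (b - real k) * M" using julia[OF b(1), of 0] by (simp add: M_def)
    then show False using b(2) M by (simp add: field_simps)
  qed
  then obtain \<beta> where \<beta>: "boundary_dilation f \<sigma> = ereal \<beta>"
    using fin by (cases "boundary_dilation f \<sigma>") auto
  have k: "\<beta> > real k" using lower M by (simp add: \<beta>) (smt (verit) divide_pos_pos)
  have "1 / (\<beta> - real k) * Re (herglotz_kernel \<sigma> z) \<le> Re ((1 + g z) / (1 - g z))"
    if z: "z \<in> unit_disc" for z
  proof -
    let ?h = "Re ((1 + g z) / (1 - g z))"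
    have "((\<lambda>b. (b - real k) * ?h) \<longlongrightarrow> (\<beta> - real k) * ?h) (at_right \<beta>)"
      by (intro tendsto_intros)
    moreover have "\<forall>\<^sub>F b in at_right \<beta>. Re (herglotz_kernel \<sigma> z) \<le> (b - real k) * ?h"
      using julia[OF _ z] by (auto simp: \<beta> eventually_at_filter)
    ultimately have "Re (herglotz_kernel \<sigma> z) \<le> (\<beta> - real k) * ?h"
      by (rule tendsto_lowerbound) simp
    then show ?thesis using k by (simp add: field_simps)
  qed
  then show ?thesis using that \<beta> k by blast
qed

text \<open>
  On the radius \<open>\<bar>1 - g\<bar> \<ge> 1 - \<bar>g\<bar>\<close> turns a lower bound \<open>d\<close> for the mass into an upper bound for the
  quotient \<open>(1 - \<bar>f\<bar>) / (1 - \<bar>z\<bar>)\<close> that tends to \<open>k + 1 / d\<close>; a lower limit over the whole disc cannot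
  exceed the one along the radius.
\<close>

lemma boundary_dilation_minorant_maximal:
  assumes g: "\<And>z. z \<in> unit_disc \<Longrightarrow> norm (g z) < 1"
    and f: "\<And>z. z \<in> unit_disc \<Longrightarrow> f z = z ^ k * g z"
    and \<sigma>: "norm \<sigma> = 1"
    and \<beta>: "boundary_dilation f \<sigma> = ereal \<beta>" "\<beta> > real k"
    and d: "\<And>z. z \<in> unit_disc \<Longrightarrow> d * Re (herglotz_kernel \<sigma> z) \<le> Re ((1 + g z) / (1 - g z))"
  shows "d \<le> 1 / (\<beta> - real k)"
proof (cases "d > 0")
  case False
  have "0 \<le> 1 / (\<beta> - real k)" using \<beta>(2) by simp
  then show ?thesis using False by linarith
next
  case True
  let ?F = "\<lambda>w. (1 - norm (f w)) / (1 - norm w)"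
  let ?\<phi> = "\<lambda>r::real. (\<Sum>i<k. r ^ i) + r ^ k * (2 / (d * (1 + r)))"
  have le: "?F (of_real r * \<sigma>) \<le> ?\<phi> r" if r: "0 < r \<and> r < 1" for r
  proof -
    define w where "w = of_real r * \<sigma>"
    have w: "w \<in> unit_disc" "norm w = r"
      using r \<sigma> by (auto simp: w_def norm_mult)
    have gw: "norm (g w) < 1" using g[OF w(1)] .
    have "d * ((1 + r) / (1 - r)) \<le> Re ((1 + g w) / (1 - g w))"
      using d[OF w(1)] by (simp add: w_def herglotz_kernel_radius[OF \<sigma>])
    also have "\<dots> \<le> (1 - (norm (g w))\<^sup>2) / (1 - norm (g w))\<^sup>2"
      unfolding Re_cayley using gw norm_triangle_ineq2[of 1 "g w"]
      by (intro divide_left_mono power_mono mult_pos_pos) (auto simp: power_le_one)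
    also have "\<dots> = (1 + norm (g w)) / (1 - norm (g w))"
    proof -
      have "1 - (norm (g w))\<^sup>2 = (1 + norm (g w)) * (1 - norm (g w))"
        by (simp add: power2_eq_square algebra_simps)
      then show ?thesis using gw by (simp add: power2_eq_square)
    qed
    also have "\<dots> \<le> 2 / (1 - norm (g w))"
      using gw by (intro divide_right_mono) auto
    finally have "(1 - norm (g w)) * (d * (1 + r)) \<le> 2 * (1 - r)"
      using r gw by (simp add: field_simps)
    then have q: "(1 - norm (g w)) / (1 - r) \<le> 2 / (d * (1 + r))"
    proof -
      have "a / p \<le> e / q" if "a * q \<le> e * p" "p > 0" "q > 0" for a e p q :: real
        using that by (simp add: field_simps)
      moreover have "1 - r > 0" "d * (1 + r) > 0" using r True by auto
      ultimately show ?thesis using \<open>(1 - norm (g w)) * (d * (1 + r)) \<le> 2 * (1 - r)\<close> by blast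
    qed
    have "?F w = (\<Sum>i<k. r ^ i) + r ^ k * ((1 - norm (g w)) / (1 - r))"
      using dilation_quotient_power[of r k "norm (g w)"] r by (simp add: f[OF w(1)] norm_mult norm_power w(2))
    moreover have "r ^ k * ((1 - norm (g w)) / (1 - r)) \<le> r ^ k * (2 / (d * (1 + r)))"
      using q r by (intro mult_left_mono) auto
    ultimately show ?thesis unfolding w_def[symmetric] by linarith
  qed
  have lim: "(?\<phi> \<longlongrightarrow> real k + 1 / d) (at_left 1)"
    by (rule tendsto_eq_intros refl)+ (use True in auto)
  have radial: "filterlim (\<lambda>r. of_real r * \<sigma>) (at \<sigma> within unit_disc) (at_left (1::real))"
    unfolding filterlim_at using tendsto_radius eventually_radius
    by (auto elim!: eventually_mono simp: norm_mult \<sigma>) (use \<sigma> in auto)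
  have "\<beta> \<le> real k + 1 / d"
  proof (rule dense_le)
    fix C assume "C < \<beta>"
    then have "ereal C < boundary_dilation f \<sigma>" by (simp add: \<beta>)
    then have "\<forall>\<^sub>F w in at \<sigma> within unit_disc. ereal C < ereal (?F w)"
      unfolding boundary_dilation_def by (rule less_LiminfD)
    then have "\<forall>\<^sub>F r in at_left 1. ereal C < ereal (?F (of_real r * \<sigma>))"
      by (rule eventually_compose_filterlim[OF _ radial])
    then have "\<forall>\<^sub>F r in at_left 1. C \<le> ?\<phi> r"
      using eventually_radius by eventually_elim (use le in fastforce)
    then show "C \<le> real k + 1 / d" using tendsto_lowerbound[OF lim] by simp
  qed
  then show ?thesis using True \<beta>(2) by (simp add: field_simps)
qed

section \<open>Dividing by a power of the variable\<close>

text \<open>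
  The quotient is the shifted Taylor series, so its value at \<open>0\<close> is the coefficient of degree \<open>k\<close>. On
  the circle of radius \<open>r\<close> it is bounded by \<open>1 / r ^ k\<close>, and the maximum principle with \<open>r \<rightarrow> 1\<close> gives
  the bound \<open>1\<close>.
\<close>

lemma holomorphic_self_map_divide_power:
  assumes hol: "f holomorphic_on unit_disc" and self: "f ` unit_disc \<subseteq> unit_disc"
    and zero: "\<forall>i<k. (deriv ^^ i) f 0 = 0"
  obtains g where "g holomorphic_on unit_disc" "\<And>z. z \<in> unit_disc \<Longrightarrow> f z = z ^ k * g z"
    "g 0 = (deriv ^^ k) f 0 / fact k" "\<And>z. z \<in> unit_disc \<Longrightarrow> norm (g z) \<le> 1"
proof -
  define a where "a = (\<lambda>n. (deriv ^^ n) f 0 / fact n)"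
  define g where "g = (\<lambda>z. if z = 0 then a k else f z / z ^ k)"
  have a0: "a i = 0" if "i < k" for i using zero that by (simp add: a_def)
  have f: "(\<lambda>n. a n * z ^ n) sums f z" if "z \<in> unit_disc" for z
    using holomorphic_power_series[OF hol that] by (simp add: a_def)
  have "(\<lambda>n. a (n + k) * (z - 0) ^ n) sums g z" if z: "z \<in> unit_disc" for z
  proof (cases "z = 0")
    case True
    then show ?thesis using powser_sums_zero[of "\<lambda>n. a (n + k)"] by (simp add: g_def)
  next
    case False
    have "(\<lambda>n. a (n + k) * z ^ (n + k)) sums (f z - (\<Sum>i<k. a i * z ^ i))"
      by (rule sums_split_initial_segment[OF f[OF z]])
    then have "(\<lambda>n. a (n + k) * z ^ (n + k)) sums f z" by (simp add: a0)
    then have "(\<lambda>n. a (n + k) * z ^ (n + k) / z ^ k) sums (f z / z ^ k)" by (rule sums_divide)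
    then show ?thesis using False by (simp add: g_def power_add)
  qed
  then have holg: "g holomorphic_on unit_disc" by (rule power_series_holomorphic)
  have fg: "f z = z ^ k * g z" if "z \<in> unit_disc" for z
  proof (cases "z = 0")
    case True
    have "f 0 = a 0" by (simp add: a_def)
    then show ?thesis using True a0[of 0] by (cases "k = 0") (auto simp: g_def)
  qed (simp add: g_def)
  have "norm (g z) \<le> 1" if z: "z \<in> unit_disc" for z
  proof -
    have bound: "norm (g z) \<le> 1 / r ^ k" if r: "norm z < r" "r < 1" for r
    proof (rule maximum_modulus_frontier[of g "cball 0 r"])
      have r0: "r > 0" using r norm_ge_zero[of z] by linarith
      have sub: "cball 0 r \<subseteq> unit_disc" using r by auto
      show "g holomorphic_on interior (cball 0 r)"
        by (rule holomorphic_on_subset[OF holg]) (use sub interior_subset in blast)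
      show "continuous_on (closure (cball 0 r)) g"
        using holomorphic_on_imp_continuous_on[OF holomorphic_on_subset[OF holg sub]] by simp
      show "norm (g w) \<le> 1 / r ^ k" if "w \<in> frontier (cball 0 r)" for w
      proof -
        have w: "norm w = r" using that r0 by simp
        then have "w \<in> unit_disc" using r by simp
        then have "f w \<in> unit_disc" using self by blast
        moreover have "norm (f w) = r ^ k * norm (g w)"
          using fg[OF \<open>w \<in> unit_disc\<close>] w by (simp add: norm_mult norm_power)
        ultimately have "r ^ k * norm (g w) < 1" by simp
        then show ?thesis using r0 by (simp add: field_simps)
      qed
    qed (use r in auto)
    have "((\<lambda>r::real. 1 / r ^ k) \<longlongrightarrow> 1 / 1 ^ k) (at_left 1)" by (intro tendsto_intros) auto
    moreover have "\<forall>\<^sub>F r in at_left 1. norm (g z) \<le> 1 / r ^ k"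
      using eventually_at_left_field[of "\<lambda>r. norm (g z) \<le> 1 / r ^ k" 1] bound z by auto
    ultimately have "norm (g z) \<le> 1 / 1 ^ k" by (rule tendsto_lowerbound) simp
    then show ?thesis by simp
  qed
  then show ?thesis using that[OF holg fg] by (simp add: g_def a_def)
qed

text \<open>
  By the maximum principle the only alternative is a unimodular constant \<open>g\<close>, for which \<open>f\<close> is a
  Blaschke product with \<open>k\<close> zeros at the origin.
\<close>

lemma quotient_not_blaschke_imp_strict:
  assumes hol: "g holomorphic_on unit_disc" and f: "\<And>z. z \<in> unit_disc \<Longrightarrow> f z = z ^ k * g z"
    and le: "\<And>z. z \<in> unit_disc \<Longrightarrow> norm (g z) \<le> 1"
    and not: "\<not> blaschke_product k f" and z: "z \<in> unit_disc"
  shows "norm (g z) < 1"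
proof (rule ccontr)
  assume "\<not> norm (g z) < 1"
  then have z1: "norm (g z) = 1" using le[OF z] by simp
  have "g constant_on unit_disc"
    by (rule maximum_modulus_principle[OF hol open_ball _ open_ball order_refl z]) (use le z1 in auto)
  then have "g w = g z" if "w \<in> unit_disc" for w using that z unfolding constant_on_def by metis
  then have "blaschke_product k f"
    by (intro blaschke_productI[where I = "{1..k}" and a = "\<lambda>_. 0" and \<omega> = "g z"])
       (auto simp: z1 f mult.commute)
  with not show False ..
qed

lemma blaschke_product_times_power:
  assumes f: "\<And>z. z \<in> unit_disc \<Longrightarrow> f z = z ^ k * g z" and "blaschke_product n g"
  shows "blaschke_product (n + k) f"
proof -
  obtain \<theta> a where a: "\<And>i. i \<in> {1..n} \<Longrightarrow> a i \<in> unit_disc"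
    and g: "\<And>z. z \<in> unit_disc \<Longrightarrow> g z = cis \<theta> * (\<Prod>i=1..n. (z - a i) / (1 - cnj (a i) * z))"
    using assms(2) unfolding blaschke_product_def by blast
  define a' where "a' = (\<lambda>i. if i \<le> n then a i else 0)"
  have "(\<Prod>i=1..n+k. (z - a' i) / (1 - cnj (a' i) * z))
      = (\<Prod>i=1..n. (z - a i) / (1 - cnj (a i) * z)) * z ^ k" for z
  proof -
    have "(\<Prod>i=1..n. (z - a' i) / (1 - cnj (a' i) * z)) = (\<Prod>i=1..n. (z - a i) / (1 - cnj (a i) * z))"
      by (rule prod.cong) (auto simp: a'_def)
    moreover have "(\<Prod>i=n+1..n+k. (z - a' i) / (1 - cnj (a' i) * z)) = (\<Prod>i=n+1..n+k. z)"
      by (rule prod.cong) (auto simp: a'_def)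
    ultimately show ?thesis by (subst prod.ub_add_nat) auto
  qed
  then show ?thesis
    by (intro blaschke_productI[where I = "{1..n+k}" and a = a' and \<omega> = "cis \<theta>"])
       (use a in \<open>auto simp: a'_def f g\<close>)
qed

lemma continuous_eq_at_0:
  fixes p q :: "complex \<Rightarrow> complex"
  assumes "continuous_on unit_disc p" "continuous_on unit_disc q"
    "\<And>z. z \<in> unit_disc \<Longrightarrow> z \<noteq> 0 \<Longrightarrow> p z = q z"
  shows "p 0 = q 0"
proof -
  have "isCont p 0" "isCont q 0"
    using assms(1,2) by (auto simp: continuous_on_eq_continuous_at)
  then have p: "(p \<longlongrightarrow> p 0) (at 0)" and q: "(q \<longlongrightarrow> q 0) (at 0)" by (auto simp: isCont_def)
  have "\<forall>\<^sub>F z in at 0. p z = q z"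
    unfolding eventually_at using assms(3) by (intro exI[of _ 1]) auto
  from Lim_transform_eventually[OF p this] q show ?thesis
    by (rule tendsto_unique[OF trivial_limit_at])
qed

text \<open>
  At least \<open>k\<close> of the zeros are at the origin, since otherwise the product of the remaining factors
  would vanish at \<open>0\<close>; removing \<open>k\<close> of them gives \<open>g\<close>, first away from \<open>0\<close> and then by continuity.
\<close>

lemma blaschke_product_divide_power:
  assumes hol: "g holomorphic_on unit_disc" and f: "\<And>z. z \<in> unit_disc \<Longrightarrow> f z = z ^ k * g z"
    and "blaschke_product (n + k) f"
  shows "blaschke_product n g"
proof -
  let ?I = "{1..n+k}"
  obtain \<theta> a where a: "\<And>i. i \<in> ?I \<Longrightarrow> a i \<in> unit_disc"
    and fa: "\<And>z. z \<in> unit_disc \<Longrightarrow> f z = cis \<theta> * (\<Prod>i\<in>?I. (z - a i) / (1 - cnj (a i) * z))"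
    using assms(3) unfolding blaschke_product_def by blast
  define Z where "Z = {i \<in> ?I. a i = 0}"
  define u where "u = (\<lambda>Y z. cis \<theta> * (\<Prod>i\<in>?I - Y. (z - a i) / (1 - cnj (a i) * z)))"
  have contu: "continuous_on unit_disc (u Y)" for Y
    unfolding u_def using a disc_automorphism_in_disc(1) by (intro continuous_intros) auto
  have contg: "continuous_on unit_disc g" by (rule holomorphic_on_imp_continuous_on[OF hol])
  have split: "f z = z ^ card Y * u Y z" if "Y \<subseteq> Z" "z \<in> unit_disc" for Y z
  proof -
    have "Y \<subseteq> ?I" using that by (auto simp: Z_def)
    then have "(\<Prod>i\<in>?I. (z - a i) / (1 - cnj (a i) * z))
        = (\<Prod>i\<in>?I - Y. (z - a i) / (1 - cnj (a i) * z)) * (\<Prod>i\<in>Y. (z - a i) / (1 - cnj (a i) * z))"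
      by (intro prod.subset_diff) auto
    also have "(\<Prod>i\<in>Y. (z - a i) / (1 - cnj (a i) * z)) = (\<Prod>i\<in>Y. z)"
      using that by (intro prod.cong) (auto simp: Z_def)
    finally show ?thesis by (simp add: fa[OF that(2)] u_def)
  qed
  have "k \<le> card Z"
  proof (rule ccontr)
    assume "\<not> k \<le> card Z"
    then have lt: "card Z < k" by simp
    have "u Z 0 = (\<lambda>z. z ^ (k - card Z) * g z) 0"
    proof (rule continuous_eq_at_0)
      show "continuous_on unit_disc (\<lambda>z. z ^ (k - card Z) * g z)" by (intro continuous_intros contg)
      fix z :: complex assume z: "z \<in> unit_disc" "z \<noteq> 0"
      have "z ^ card Z * u Z z = z ^ (card Z + (k - card Z)) * g z"
        using split[OF order_refl z(1)] f[OF z(1)] lt by simp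
      then have "z ^ card Z * u Z z = z ^ card Z * (z ^ (k - card Z) * g z)"
        by (simp only: power_add mult.assoc)
      then show "u Z z = z ^ (k - card Z) * g z" using z by simp
    qed (rule contu)
    also have "\<dots> = 0" using lt by simp
    finally show False by (simp add: u_def Z_def)
  qed
  then obtain Y where Y: "Y \<subseteq> Z" "card Y = k" by (meson obtain_subset_with_card_n)
  have YI: "Y \<subseteq> ?I" using Y by (auto simp: Z_def)
  have gu: "g z = u Y z" if z: "z \<in> unit_disc" "z \<noteq> 0" for z
    using split[OF Y(1) z(1)] f[OF z(1)] z(2) Y(2) by simp
  have g0: "g 0 = u Y 0" by (rule continuous_eq_at_0[OF contg contu gu])
  show ?thesis
  proof (rule blaschke_productI[where I = "?I - Y" and a = a and \<omega> = "cis \<theta>"])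
    show "card (?I - Y) = n" using YI Y(2) by (simp add: card_Diff_subset finite_subset)
    show "g z = cis \<theta> * (\<Prod>i\<in>?I - Y. (z - a i) / (1 - cnj (a i) * z))" if "z \<in> unit_disc" for z
      using gu[OF that] g0 by (cases "z = 0") (auto simp: u_def)
  qed (use a in auto)
qed

section \<open>The inequality and its equality case\<close>

lemma nontangential_imp_radial_limit:
  assumes "has_nontangential_limit f \<sigma> l" and \<sigma>: "norm \<sigma> = 1"
  shows "((\<lambda>r. f (of_real r * \<sigma>)) \<longlongrightarrow> l) (at_left (1::real))"
proof -
  have "of_real r * \<sigma> \<in> stolz_region \<sigma> 2 \<and> of_real r * \<sigma> \<noteq> \<sigma>" if r: "0 < r \<and> r < 1" for r :: real
  proof -
    have "norm (\<sigma> - of_real r * \<sigma>) = 1 - r" using norm_diff_radius[OF \<sigma>] r by simp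
    moreover have "norm (of_real r * \<sigma>) = r" using \<sigma> r by (simp add: norm_mult)
    ultimately show ?thesis using r \<sigma> by (auto simp: stolz_region_def)
  qed
  then have "\<forall>\<^sub>F r in at_left (1::real). of_real r * \<sigma> \<in> stolz_region \<sigma> 2 \<and> of_real r * \<sigma> \<noteq> \<sigma>"
    by (rule eventually_mono[OF eventually_radius])
  then have "filterlim (\<lambda>r. of_real r * \<sigma>) (at \<sigma> within stolz_region \<sigma> 2) (at_left (1::real))"
    using tendsto_radius by (simp add: filterlim_at)
  moreover have "(f \<longlongrightarrow> l) (at \<sigma> within stolz_region \<sigma> 2)"
    using assms(1) by (simp add: has_nontangential_limit_def)
  ultimately show ?thesis by (rule filterlim_compose[rotated])
qed

theorem corollary1p10:
  fixes f :: "complex \<Rightarrow> complex" and \<sigma> :: "nat \<Rightarrow> complex" and k n :: nat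
  assumes "f holomorphic_on unit_disc"
    and "f ` unit_disc \<subseteq> unit_disc"
    and "k \<ge> 1"
    and "n \<ge> 1"
    and "\<not> (\<exists>d\<le>k. blaschke_product d f)"
    and "\<forall>i<k. (deriv ^^ i) f 0 = 0"
    and "\<forall>j\<in>{1..n}. \<sigma> j \<in> sphere 0 1"
    and "inj_on \<sigma> {1..n}"
    and "\<forall>j\<in>{1..n}. boundary_dilation f (\<sigma> j) < \<infinity>"
    and "\<forall>j\<in>{1..n}. has_nontangential_limit f (\<sigma> j) (\<sigma> j ^ k)"
  shows "(\<Sum>j=1..n. 1 / (real_of_ereal (boundary_dilation f (\<sigma> j)) - real k))
           \<le> (1 - (norm ((deriv ^^ k) f 0 / fact k))\<^sup>2) / (norm (1 - (deriv ^^ k) f 0 / fact k))\<^sup>2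
       \<and> ((\<Sum>j=1..n. 1 / (real_of_ereal (boundary_dilation f (\<sigma> j)) - real k))
           = (1 - (norm ((deriv ^^ k) f 0 / fact k))\<^sup>2) / (norm (1 - (deriv ^^ k) f 0 / fact k))\<^sup>2
          \<longleftrightarrow> blaschke_product (n + k) f)"
proof -
  let ?J = "{1..n}"
  obtain g where holg: "g holomorphic_on unit_disc" and f: "\<And>z. z \<in> unit_disc \<Longrightarrow> f z = z ^ k * g z"
    and g0: "g 0 = (deriv ^^ k) f 0 / fact k" and gle: "\<And>z. z \<in> unit_disc \<Longrightarrow> norm (g z) \<le> 1"
    using holomorphic_self_map_divide_power[OF assms(1,2,6)] by blast
  have "\<not> blaschke_product k f" using assms(5) by blast
  then have g: "norm (g z) < 1" if "z \<in> unit_disc" for z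
    using quotient_not_blaschke_imp_strict[OF holg f gle _ that] by blast
  define h where "h = (\<lambda>z. (1 + g z) / (1 - g z))"
  define c where "c = (\<lambda>j. 1 / (real_of_ereal (boundary_dilation f (\<sigma> j)) - real k))"
  have \<sigma>: "norm (\<sigma> j) = 1" if "j \<in> ?J" for j using assms(7) that by auto
  have glim: "((\<lambda>r. g (of_real r * \<sigma> j)) \<longlongrightarrow> 1) (at_left (1::real))" if j: "j \<in> ?J" for j
  proof -
    have s0: "\<sigma> j \<noteq> 0" using \<sigma>[OF j] by auto
    have "((\<lambda>r. f (of_real r * \<sigma> j) / (of_real r * \<sigma> j) ^ k) \<longlongrightarrow> \<sigma> j ^ k / \<sigma> j ^ k) (at_left (1::real))"
      using assms(10) j s0
      by (intro tendsto_intros nontangential_imp_radial_limit \<sigma> tendsto_radius) auto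
    moreover have "\<forall>\<^sub>F r in at_left (1::real). f (of_real r * \<sigma> j) / (of_real r * \<sigma> j) ^ k = g (of_real r * \<sigma> j)"
      using eventually_radius
      by eventually_elim (use f radius_in_disc[OF \<sigma>[OF j]] s0 in simp)
    ultimately show ?thesis using Lim_transform_eventually s0 by force
  qed
  have loc: "c j > 0"
      "\<And>z. z \<in> unit_disc \<Longrightarrow> c j * Re (herglotz_kernel (\<sigma> j) z) \<le> Re (h z)"
      "\<And>d. (\<And>z. z \<in> unit_disc \<Longrightarrow> d * Re (herglotz_kernel (\<sigma> j) z) \<le> Re (h z)) \<Longrightarrow> d \<le> c j"
    if j: "j \<in> ?J" for j
  proof -
    obtain \<beta> where \<beta>: "boundary_dilation f (\<sigma> j) = ereal \<beta>" "\<beta> > real k"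
      "\<And>z. z \<in> unit_disc \<Longrightarrow> 1 / (\<beta> - real k) * Re (herglotz_kernel (\<sigma> j) z) \<le> Re ((1 + g z) / (1 - g z))"
      using boundary_dilation_minorant[OF holg g f \<sigma>[OF j] glim[OF j]] assms(9) j by blast
    have c: "c j = 1 / (\<beta> - real k)" by (simp add: c_def \<beta>(1))
    show "c j > 0" using \<beta>(2) by (simp add: c)
    show "c j * Re (herglotz_kernel (\<sigma> j) z) \<le> Re (h z)" if "z \<in> unit_disc" for z
      unfolding c h_def by (rule \<beta>(3)[OF that])
    show "d \<le> c j" if "\<And>z. z \<in> unit_disc \<Longrightarrow> d * Re (herglotz_kernel (\<sigma> j) z) \<le> Re (h z)" for d
      unfolding c using that
      by (intro boundary_dilation_minorant_maximal[OF g f \<sigma>[OF j] \<beta>(1,2)]) (auto simp: h_def)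
  qed
  have holh: "h holomorphic_on unit_disc" unfolding h_def by (rule cayley_holomorphic[OF holg g])
  have posh: "Re (h z) \<ge> 0" if "z \<in> unit_disc" for z
    unfolding h_def by (rule less_imp_le[OF cayley_pos[OF g[OF that]]])
  define H where "H = (\<lambda>z. h z - (\<Sum>j\<in>?J. of_real (c j) * herglotz_kernel (\<sigma> j) z))"
  have ker0: "Re (herglotz_kernel (\<sigma> j) 0) = 1" if "j \<in> ?J" for j
    using \<sigma>[OF that] by (simp add: Re_herglotz_kernel)
  have posH: "Re (H z) \<ge> 0" if "z \<in> unit_disc" for z
    using herglotz_minorants_add[OF holh _ assms(8) \<sigma> posh loc(2) that] by (simp add: H_def)
  have H0: "Re (H 0) = Re (h 0) - (\<Sum>j\<in>?J. c j)" using ker0 by (simp add: H_def)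
  have ineq: "(\<Sum>j\<in>?J. c j) \<le> Re (h 0)" using posH[of 0] H0 by simp
  have "(\<Sum>j\<in>?J. c j) = Re (h 0) \<longleftrightarrow> blaschke_product (n + k) f"
  proof
    assume "(\<Sum>j\<in>?J. c j) = Re (h 0)"
    then have R0: "Re (H 0) = 0" using H0 by simp
    have holH: "H holomorphic_on unit_disc"
      unfolding H_def using \<sigma> by (intro holomorphic_intros holh herglotz_kernel_holomorphic) auto
    have "h z = H 0 + (\<Sum>j\<in>?J. of_real (c j) * herglotz_kernel (\<sigma> j) z)" if "z \<in> unit_disc" for z
      using Re_nonneg_vanishing_imp_constant[OF holH posH R0 that] by (simp add: H_def diff_eq_eq)
    from herglotz_sum_cayley_blaschke[OF _ assms(8) \<sigma> loc(1) R0 this]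
    have b: "blaschke_product n (\<lambda>z. (h z - 1) / (h z + 1))" by simp
    have "(h z - 1) / (h z + 1) = g z" if "z \<in> unit_disc" for z
    proof -
      have "1 - g z \<noteq> 0" using g[OF that] by auto
      then have "h z - 1 = 2 * g z / (1 - g z)" "h z + 1 = 2 / (1 - g z)"
        by (simp_all add: h_def field_simps)
      then show ?thesis using \<open>1 - g z \<noteq> 0\<close> by simp
    qed
    then have "f z = z ^ k * ((h z - 1) / (h z + 1))" if "z \<in> unit_disc" for z
      using f[OF that] that by simp
    then show "blaschke_product (n + k) f" by (rule blaschke_product_times_power[OF _ b])
  next
    assume "blaschke_product (n + k) f"
    then have "blaschke_product (card ?J) g" using blaschke_product_divide_power[OF holg f] by simp
    from blaschke_cayley_total_mass[OF _ assms(8) \<sigma> loc(1) this g glim _ holh loc(2,3)]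
    show "(\<Sum>j\<in>?J. c j) = Re (h 0)" by (simp add: h_def)
  qed
  moreover have "Re (h 0) = (1 - (norm ((deriv ^^ k) f 0 / fact k))\<^sup>2) / (norm (1 - (deriv ^^ k) f 0 / fact k))\<^sup>2"
    unfolding h_def Re_cayley g0 ..
  ultimately show ?thesis using ineq unfolding c_def by metis
qed

end
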